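(* Let $A$ and $B$ be subalgebras of an effect algebra $E$ such that $E = A\cup B$. Then there is a long exact sequence of real vector spaces $$\cdots\to\mathrm{HC}^{n-1}(A\cap B)\to\mathrm{HC}^n(E)\to\mathrm{HC}^n(A)\oplus\mathrm{HC}^n(B)\to\mathrm{HC}^n(A\cap B)\to\mathrm{HC}^{n+1}(E)\to\cdots$$
   Context: An effect algebra is a set $A$ with a partial binary operation $\boxplus$, a unary operation $(-)^\bot$ and elements $0,1\in A$ such that: if $a\boxplus b$ is defined then so is $b\boxplus a$ and they are equal; if $a\boxplus b$ and $(a\boxplus b)\boxplus c$ are defined then so are $b\boxplus c$ and $a\boxplus(b\boxplus c)$, and $(a\boxplus b)\boxplus c=a\boxplus(b\boxplus c)$; $0\boxplus a$ is always defined and equals $a$; for each $a$, $a^\bot$ is the unique element with $a\boxplus a^\bot=1$; if $a\boxplus 1$ is defined then $a=0$. A subalgebra of an effect algebra $E$ is a subset $A\subseteq E$ containing $0,1$, closed under $(-)^\bot$, and such that whenever $a,a'\in A$ and $a\boxplus a'$ is defined in $E$, then $a\boxplus a'\in A$; it is an effect algebra with $\boxplus$ restricted from $E$ (so a sum of elements of $A$ is defined in $A$ iff it is defined in $E$). Cyclic cohomology (coefficients in $\mathbb{R}$): for $n\ge 0$ let $T_n(A)=\{(a_0,\dots,a_n)\in A^{n+1}\mid a_0\boxplus\cdots\boxplus a_n \text{ is defined and equals } 1\}$. Let $C^n(A)=\mathbb{R}^{T_n(A)}$ with coboundary $\delta^n:C^n(A)\to C^{n+1}(A)$, $$\delta^n(\alpha)(a_0,\dots,a_{n+1})=\sum_{i=0}^{n}(-1)^i\alpha(a_0,\dots,a_i\boxplus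 a_{i+1},\dots,a_{n+1})+(-1)^{n+1}\alpha(a_{n+1}\boxplus a_0,a_1,\dots,a_n).$$ Let $C^n_\lambda(A)\subseteq C^n(A)$ be the subspace of $\alpha$ with $\alpha(a_0,\dots,a_n)=(-1)^n\alpha(a_n,a_0,\dots,a_{n-1})$ for all tests; these form a subcomplex. The cyclic cohomology $\mathrm{HC}^n(A)$ is the $n$-th cohomology of $C_\lambda^\bullet(A)$, and $\mathrm{HC}^n=0$ for $n<0$. *)

theory Defs
  imports "Jordan_Normal_Form.VS_Connect" "HOL-Algebra.AbelCoset"
begin

section \<open>Effect algebras\<close>

text \<open>The partial sum is a total function into \<^typ>\<open>'a option\<close>; \<^term>\<open>None\<close> means ``undefined''.\<close>

record 'a effect_algebra = "'a partial_object" +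
  osum :: "'a \<Rightarrow> 'a \<Rightarrow> 'a option"
  ocompl :: "'a \<Rightarrow> 'a"
  ozero :: 'a
  oone :: 'a

locale effect_algebra =
  fixes E :: "('a, 'm) effect_algebra_scheme"
  assumes osum_closed:
      "\<lbrakk>a \<in> carrier E; b \<in> carrier E; osum E a b = Some c\<rbrakk> \<Longrightarrow> c \<in> carrier E"
    and ocompl_closed: "a \<in> carrier E \<Longrightarrow> ocompl E a \<in> carrier E"
    and ozero_closed: "ozero E \<in> carrier E"
    and oone_closed: "oone E \<in> carrier E"
    and osum_comm:
      "\<lbrakk>a \<in> carrier E; b \<in> carrier E; osum E a b = Some c\<rbrakk> \<Longrightarrow> osum E b a = Some c"
    and osum_assoc:
      "\<lbrakk>a \<in> carrier E; b \<in> carrier E; c \<in> carrier E; osum E a b = Some d; osum E d c = Some e\<rbrakk>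
        \<Longrightarrow> \<exists>f. osum E b c = Some f \<and> osum E a f = Some e"
    and osum_zero: "a \<in> carrier E \<Longrightarrow> osum E (ozero E) a = Some a"
    and osum_ocompl: "a \<in> carrier E \<Longrightarrow> osum E a (ocompl E a) = Some (oone E)"
    and ocompl_unique:
      "\<lbrakk>a \<in> carrier E; b \<in> carrier E; osum E a b = Some (oone E)\<rbrakk> \<Longrightarrow> b = ocompl E a"
    and osum_one:
      "\<lbrakk>a \<in> carrier E; osum E a (oone E) = Some b\<rbrakk> \<Longrightarrow> a = ozero E"

locale effect_subalgebra =
  fixes A :: "'a set" and E :: "('a, 'm) effect_algebra_scheme"
  assumes subset: "A \<subseteq> carrier E"
    and ozero_mem: "ozero E \<in> A"
    and oone_mem: "oone E \<in> A"
    and ocompl_mem: "a \<in> A \<Longrightarrow> ocompl E a \<in> A"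
    and osum_mem: "\<lbrakk>a \<in> A; b \<in> A; osum E a b = Some c\<rbrakk> \<Longrightarrow> c \<in> A"

text \<open>The values of \<^const>\<open>osum\<close> outside the carrier are irrelevant, so a subalgebra \<open>A\<close>, regarded as
  an effect algebra, is \<open>E\<lparr>carrier := A\<rparr>\<close>.\<close>

lemma (in effect_algebra) subalgebra_is_effect_algebra:
  assumes "effect_subalgebra A E"
  shows "effect_algebra (E\<lparr>carrier := A\<rparr>)"
proof -
  interpret A: effect_subalgebra A E by fact
  have mem: "a \<in> carrier E" if "a \<in> A" for a using A.subset that by blast
  let ?A = "E\<lparr>carrier := A\<rparr>"
  show ?thesis
  proof (rule effect_algebra.intro)
    show "\<exists>f. osum ?A b c = Some f \<and> osum ?A a f = Some e"
      if "a \<in> carrier ?A" "b \<in> carrier ?A" "c \<in> carrier ?A"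
        "osum ?A a b = Some d" "osum ?A d c = Some e" for a b c d e
      using osum_assoc[of a b c d e] that mem by simp
    show "a = ozero ?A" if "a \<in> carrier ?A" "osum ?A a (oone ?A) = Some b" for a b
      using osum_one[of a b] that mem by simp
    show "osum ?A b a = Some c"
      if "a \<in> carrier ?A" "b \<in> carrier ?A" "osum ?A a b = Some c" for a b c
      using osum_comm[of a b c] that mem by simp
    show "c \<in> carrier ?A"
      if "a \<in> carrier ?A" "b \<in> carrier ?A" "osum ?A a b = Some c" for a b c
      using A.osum_mem[of a b c] that by simp
    show "b = ocompl ?A a"
      if "a \<in> carrier ?A" "b \<in> carrier ?A" "osum ?A a b = Some (oone ?A)" for a b
      using ocompl_unique[of a b] that mem by simp
  qed (simp_all add: A.ocompl_mem A.ozero_mem A.oone_mem mem osum_zero osum_ocompl)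
qed

text \<open>Iterated sums are bracketed to the right and end in \<open>\<dots> \<boxplus> 0\<close>. By the axioms, neither the
  definedness nor the value of the sum of a nonempty list depends on this choice.\<close>

primrec osum_list :: "('a, 'm) effect_algebra_scheme \<Rightarrow> 'a list \<Rightarrow> 'a option" where
  "osum_list E [] = Some (ozero E)"
| "osum_list E (a # as) = Option.bind (osum_list E as) (osum E a)"


section \<open>Cyclic cohomology with real coefficients\<close>

text \<open>Degrees are integers. There are no tests in negative degrees, so cochain spaces (functions on
  the empty set) and hence cohomology vanish there.\<close>

definition tests :: "('a, 'm) effect_algebra_scheme \<Rightarrow> int \<Rightarrow> 'a list set" where
  "tests E n = {as. 0 \<le> n \<and> int (length as) = n + 1 \<and> set as \<subseteq> carrier E
                    \<and> osum_list E as = Some (oone E)}"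

text \<open>\<^term>\<open>ring.func_space class_ring T\<close> is the real vector space of functions on \<open>T\<close>, which
  are \<^const>\<open>undefined\<close> outside \<open>T\<close>.\<close>

definition cochains ::
  "('a, 'm) effect_algebra_scheme \<Rightarrow> int \<Rightarrow> (real, 'a list \<Rightarrow> real) module" where
  "cochains E n = ring.func_space class_ring (tests E n)"

definition merge_at :: "('a, 'm) effect_algebra_scheme \<Rightarrow> nat \<Rightarrow> 'a list \<Rightarrow> 'a list" where
  "merge_at E i as = take i as @ the (osum E (as ! i) (as ! Suc i)) # drop (i + 2) as"

definition cyclic_merge :: "('a, 'm) effect_algebra_scheme \<Rightarrow> 'a list \<Rightarrow> 'a list" where
  "cyclic_merge E as = the (osum E (last as) (hd as)) # butlast (tl as)"

text \<open>In degree \<open>-1\<close> the coboundary is the zero map out of the zero space.\<close>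

definition coboundary ::
  "('a, 'm) effect_algebra_scheme \<Rightarrow> int \<Rightarrow> ('a list \<Rightarrow> real) \<Rightarrow> 'a list \<Rightarrow> real" where
  "coboundary E n \<alpha> = (\<lambda>as \<in> tests E (n + 1).
     if n < 0 then 0
     else (\<Sum>i\<le>nat n. (-1) ^ i * \<alpha> (merge_at E i as)) + (-1) ^ (nat n + 1) * \<alpha> (cyclic_merge E as))"

definition cyclic_cochains ::
  "('a, 'm) effect_algebra_scheme \<Rightarrow> int \<Rightarrow> ('a list \<Rightarrow> real) set" where
  "cyclic_cochains E n = {\<alpha> \<in> carrier (cochains E n).
     \<forall>as \<in> tests E n. \<alpha> as = (-1) ^ nat n * \<alpha> (last as # butlast as)}"

definition cyclic_cocycles ::
  "('a, 'm) effect_algebra_scheme \<Rightarrow> int \<Rightarrow> ('a list \<Rightarrow> real) set" where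
  "cyclic_cocycles E n =
     {\<alpha> \<in> cyclic_cochains E n. coboundary E n \<alpha> = \<zero>\<^bsub>cochains E (n + 1)\<^esub>}"

definition cyclic_coboundaries ::
  "('a, 'm) effect_algebra_scheme \<Rightarrow> int \<Rightarrow> ('a list \<Rightarrow> real) set" where
  "cyclic_coboundaries E n = coboundary E (n - 1) ` cyclic_cochains E (n - 1)"

text \<open>The quotient of a module by a submodule \<open>N\<close>. Adding \<open>N\<close> in the scalar multiplication is needed
  for the scalar \<open>0\<close>. The fields \<^const>\<open>mult\<close> and \<^const>\<open>one\<close> play no role for modules.\<close>

definition quot_module :: "('r, 'v, 'm) module_scheme \<Rightarrow> 'v set \<Rightarrow> ('r, 'v set) module" where
  "quot_module M N =
     \<lparr>carrier = a_rcosets\<^bsub>M\<^esub> N, mult = (\<lambda>_ _. N), one = N, zero = N,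
      add = set_add M,
      smult = (\<lambda>c X. N <+>\<^bsub>M\<^esub> ((\<lambda>x. c \<odot>\<^bsub>M\<^esub> x) ` X))\<rparr>"

definition HC ::
  "('a, 'm) effect_algebra_scheme \<Rightarrow> int \<Rightarrow> (real, ('a list \<Rightarrow> real) set) module" where
  "HC E n = quot_module ((cochains E n)\<lparr>carrier := cyclic_cocycles E n\<rparr>) (cyclic_coboundaries E n)"

lemma carrier_HC_neg:
  assumes "n < 0"
  shows "carrier (HC E n) = {\<zero>\<^bsub>HC E n\<^esub>}"
proof -
  have fs: "ring.func_space class_ring S = \<lparr>carrier = S \<rightarrow>\<^sub>E (UNIV :: real set),
      mult = (\<lambda>f g. restrict (\<lambda>v. 0) S), one = restrict (\<lambda>v. 0) S, zero = restrict (\<lambda>v. 0) S,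
      add = (\<lambda>f g. restrict (\<lambda>v. f v + g v) S), smult = (\<lambda>c f. restrict (\<lambda>v. c * f v) S)\<rparr>"
    for S :: "'a list set"
    by (subst ring.func_space_def) (auto intro: class_ring.ring_axioms)
  have cyc: "cyclic_cochains E m = {\<lambda>_. undefined}" if "m < 0" for m
    using that by (auto simp: cyclic_cochains_def cochains_def fs tests_def)
  have "cyclic_cocycles E n = {\<lambda>_. undefined}"
    using assms by (auto simp: cyclic_cocycles_def cyc coboundary_def cochains_def fs tests_def)
  moreover have "cyclic_coboundaries E n = {\<lambda>_. undefined}"
    using assms by (auto simp: cyclic_coboundaries_def cyc coboundary_def tests_def)
  ultimately show ?thesis
    using assms by (simp add: HC_def quot_module_def A_RCOSETS_def RCOSETS_def r_coset_def
        cochains_def fs tests_def)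
qed

text \<open>For a subalgebra \<open>A\<close> of an effect algebra, the map from the cohomology of the ambient algebra to
  the cohomology of \<open>A\<close> induced by restricting cochains, \<open>[\<alpha>] \<mapsto> [\<alpha>|\<^bsub>T\<^sub>n(A)\<^esub>]\<close>. The union is over
  the representatives \<open>\<alpha>\<close> of the class \<open>\<xi>\<close>, all of which yield the same coset.\<close>

definition HC_restrict ::
  "('a, 'm) effect_algebra_scheme \<Rightarrow> int \<Rightarrow> ('a list \<Rightarrow> real) set \<Rightarrow> ('a list \<Rightarrow> real) set" where
  "HC_restrict A n \<xi> =
     (\<Union>\<alpha> \<in> \<xi>. cyclic_coboundaries A n +>\<^bsub>cochains A n\<^esub> restrict \<alpha> (tests A n))"


text \<open>For subalgebras \<open>A\<close>, \<open>B\<close>, \<open>C = A \<inter> B\<close>: \<open>\<xi> \<mapsto> (\<xi>|\<^bsub>A\<^esub>, \<xi>|\<^bsub>B\<^esub>)\<close> and \<open>(\<xi>, \<eta>) \<mapsto> \<xi>|\<^bsub>C\<^esub> - \<eta>|\<^bsub>C\<^esub>\<close>.\<close>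

definition HC_restrict_pair where
  "HC_restrict_pair A B n \<xi> = (HC_restrict A n \<xi>, HC_restrict B n \<xi>)"

definition HC_restrict_diff where
  "HC_restrict_diff C n = (\<lambda>(\<xi>, \<eta>). HC_restrict C n \<xi> \<ominus>\<^bsub>HC C n\<^esub> HC_restrict C n \<eta>)"


section \<open>Exactness\<close>

text \<open>Exactness of \<open>U \<rightarrow> V \<rightarrow> W\<close> (maps \<open>f\<close>, \<open>g\<close>) at \<open>V\<close>; \<^const>\<open>linear_map\<close> includes that domain and
  codomain are vector spaces.\<close>

definition exact_at ::
  "('k, 'r) ring_scheme \<Rightarrow> ('k, 'u, 'm1) module_scheme \<Rightarrow> ('u \<Rightarrow> 'v) \<Rightarrow>
   ('k, 'v, 'm2) module_scheme \<Rightarrow> ('v \<Rightarrow> 'w) \<Rightarrow> ('k, 'w, 'm3) module_scheme \<Rightarrow> bool" where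
  "exact_at K U f V g W \<longleftrightarrow>
     linear_map K U V f \<and> linear_map K V W g \<and> f ` carrier U = a_kernel V W g"

end

theory Submission
  imports Defs
begin

text \<open>No test of \<open>E\<close> has entries both in \<open>A - B\<close> and in \<open>B - A\<close>: the sum of two such entries would lie
  in \<open>A\<close> or in \<open>B\<close>, and by cancellation so would both entries. Hence the tests of \<open>E\<close> are the union of the
  tests of \<open>A\<close> and of \<open>B\<close>, cyclic cochains on \<open>E\<close> are pairs of cyclic cochains on \<open>A\<close> and \<open>B\<close> that agree
  on \<open>A \<inter> B\<close>, and extension by zero (compatible with rotations) shows that every cyclic cochain on
  \<open>A \<inter> B\<close> extends to \<open>A\<close>. The long exact sequence is the one of the resulting short exact sequence of
  complexes; the connecting map sends \<open>\<gamma>\<close> to the coboundary of its extension to \<open>A\<close>, glued to \<open>0\<close> on \<open>B\<close>.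

  That the cyclic cochains form a complex follows by writing the coboundary of a cyclic cochain as a
  signed sum over all rotations of the operator that merges the first two entries. In \<open>\<delta>\<delta>\<alpha>\<close>, the term
  with rotations \<open>(i, j)\<close> then cancels against the one with rotations \<open>(i + j + 1, n + 1 - j)\<close>.\<close>

section \<open>Cyclic cochains\<close>

text \<open>Moving the window of summation by one step drops \<open>f k\<close> and adds
  \<open>f (L + k)\<close>, which are equal. The rotation index may thus be shifted in a sum over
  all rotations.\<close>

lemma sum_shift_periodic:
  fixes f :: "nat \<Rightarrow> 'b::comm_monoid_add"
  assumes "\<And>i. f (i + L) = f i"
  shows "(\<Sum>i<L. f (i + k)) = (\<Sum>i<L. f i)"
proof (induction k)
  case (Suc k)
  have "(\<Sum>i<L. f (i + Suc k)) = (\<Sum>i<L. f (i + k))"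
  proof (cases L)
    case (Suc M)
    have "(\<Sum>i<L. f (Suc i + k)) = (\<Sum>i<M. f (Suc i + k)) + f (L + k)"
      by (simp add: Suc)
    also have "f (L + k) = f (0 + k)" using assms[of k] by (simp add: add.commute)
    also have "(\<Sum>i<M. f (Suc i + k)) + f (0 + k) = (\<Sum>i<L. f (i + k))"
      unfolding Suc by (subst sum.lessThan_Suc_shift) (simp add: add.commute)
    finally show ?thesis by simp
  qed simp
  then show ?case using Suc.IH by simp
qed simp

lemma neg_one_power_opposite:
  assumes "even a = odd b"
  shows "(-1) ^ a = - ((-1) ^ b :: 'b::ring_1)"
  using assms by (cases "even a") (simp_all add: minus_one_power_iff)

text \<open>The rotation carries the first \<open>i\<close> entries to the end, and the merge at
  \<open>i\<close> does not touch them. Every inner face is thereby reduced to the front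
  merge.\<close>

lemma rotate_merge_at:
  assumes "Suc i < length as"
  shows "rotate i (merge_at E i as) = merge_at E 0 (rotate i as)"
proof -
  have d: "drop i as = as ! i # as ! Suc i # drop (i + 2) as"
    using assms by (simp add: Cons_nth_drop_Suc)
  have "rotate i as = drop i as @ take i as"
    using assms by (simp add: rotate_drop_take)
  then have "merge_at E 0 (rotate i as)
      = the (osum E (as ! i) (as ! Suc i)) # drop (i + 2) as @ take i as"
    by (simp add: d merge_at_def)
  moreover have "rotate i (take i as @ xs) = xs @ take i as" for xs
    using assms rotate_append[of "take i as" xs] by simp
  ultimately show ?thesis by (simp add: merge_at_def)
qed

text \<open>Rotating by one less than the length puts the last entry in front of the first, which
  makes the wrap-around face a front merge too.\<close>

lemma cyclic_merge_rotate:
  assumes "length as = m + 2"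
  shows "cyclic_merge E as = merge_at E 0 (rotate (m + 1) as)"
proof -
  obtain b bs where as: "as = b # bs" and "bs \<noteq> []"
    using assms by (cases as) (auto simp: length_Suc_conv)
  then obtain cs c where bs: "bs = cs @ [c]" by (metis rev_exhaust)
  have "rotate (m + 1) as = c # b # cs"
    using rotate_append[of "b # cs" "[c]"] assms by (simp add: as bs)
  then show ?thesis by (simp add: as bs cyclic_merge_def merge_at_def)
qed

lemma carrier_cochains [simp]: "carrier (cochains E n) = tests E n \<rightarrow>\<^sub>E UNIV"
  and add_cochains [simp]: "add (cochains E n) = (\<lambda>f g. restrict (\<lambda>v. f v + g v) (tests E n))"
  and zero_cochains [simp]: "zero (cochains E n) = restrict (\<lambda>v. 0) (tests E n)"
  and smult_cochains [simp]:
    "module.smult (cochains E n) = (\<lambda>c f. restrict (\<lambda>v. c * f v) (tests E n))"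
  unfolding cochains_def
  by (subst ring.func_space_def; auto intro: class_ring.ring_axioms)+

context effect_algebra
begin

section \<open>Partial sums of lists, cancellation and summands\<close>

lemma osum_list_closed:
  "\<lbrakk>set as \<subseteq> carrier E; osum_list E as = Some s\<rbrakk> \<Longrightarrow> s \<in> carrier E"
  by (induction as arbitrary: s)
    (auto simp: ozero_closed bind_eq_Some_conv intro: osum_closed)

text \<open>The head is carried past one entry at a time: with \<open>s\<close> the sum of
  \<open>as\<close>, \<open>a \<boxplus> (b \<boxplus> s)\<close> regroups to
  \<open>b \<boxplus> (s \<boxplus> a)\<close>, and the induction hypothesis evaluates the inner
  sum.\<close>

lemma osum_list_snoc:
  "\<lbrakk>set (a # as) \<subseteq> carrier E; osum_list E (a # as) = Some t\<rbrakk> \<Longrightarrow> osum_list E (as @ [a]) = Some t"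
proof (induction as arbitrary: t)
  case (Cons b as)
  then obtain s u where s: "osum_list E as = Some s" "osum E b s = Some u" "osum E a u = Some t"
    by (auto simp: bind_eq_Some_conv)
  have mem: "a \<in> carrier E" "b \<in> carrier E" "s \<in> carrier E" "u \<in> carrier E"
    using Cons.prems s osum_list_closed[of as s] osum_closed[of b s u] by auto
  obtain v where v: "osum E s a = Some v" "osum E b v = Some t"
    using osum_assoc[of b s a u t] osum_comm[of a u t] mem s by auto
  have "osum_list E (a # as) = Some v" using v osum_comm[of s a v] mem s by simp
  then have "osum_list E (as @ [a]) = Some v" using Cons by simp
  then show ?case using v by simp
qed simp

text \<open>\<open>osum_assoc\<close> regroups from left to right only, whereas
  \<open>osum_list\<close> is bracketed to the right. Commutativity supplies the other direction by
  reversing the order: \<open>(s \<boxplus> b) \<boxplus> a\<close> regroups to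
  \<open>s \<boxplus> (b \<boxplus> a)\<close>.\<close>

lemma osum_list_merge:
  assumes "set (a # b # as) \<subseteq> carrier E" "osum_list E (a # b # as) = Some t"
  obtains c where "osum E a b = Some c" "c \<in> carrier E" "osum_list E (c # as) = Some t"
proof -
  obtain s u where s: "osum_list E as = Some s" "osum E b s = Some u" "osum E a u = Some t"
    using assms by (auto simp: bind_eq_Some_conv)
  have mem: "a \<in> carrier E" "b \<in> carrier E" "s \<in> carrier E" "u \<in> carrier E"
    using assms s osum_list_closed[of as s] osum_closed[of b s u] by auto
  obtain v where v: "osum E b a = Some v" "osum E s v = Some t"
    using osum_assoc[of s b a u t] osum_comm[of a u t] osum_comm[of b s u] mem s by auto
  have c: "v \<in> carrier E" "osum E a b = Some v"
    using osum_closed[of b a v] osum_comm[of b a v] v mem by auto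
  moreover have "osum_list E (v # as) = Some t"
    using s osum_comm[of s v t] v c mem by simp
  ultimately show thesis using that by blast
qed

text \<open>Regrouping \<open>(y \<boxplus> x) \<boxplus> ocompl E c\<close>, which is the unit,
  shows that \<open>y\<close> is the complement of \<open>x \<boxplus> ocompl E c\<close>, a sum of
  two elements of \<open>S\<close>.\<close>

lemma summand_mem:
  assumes "effect_subalgebra S E" "x \<in> S" "y \<in> carrier E" "osum E x y = Some c" "c \<in> S"
  shows "y \<in> S"
proof -
  interpret S: effect_subalgebra S E by fact
  have mem: "x \<in> carrier E" "c \<in> carrier E" "ocompl E c \<in> carrier E" "ocompl E c \<in> S"
    using assms S.subset ocompl_closed S.ocompl_mem by auto
  have "osum E y x = Some c" using assms mem osum_comm by blast
  then obtain d where d: "osum E x (ocompl E c) = Some d" "osum E y d = Some (oone E)"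
    using osum_assoc[of y x "ocompl E c" c "oone E"] osum_ocompl[of c] mem assms by auto
  have "d \<in> S" using S.osum_mem[of x "ocompl E c" d] d mem assms by simp
  moreover from this have "osum E d y = Some (oone E)"
    using osum_comm[of y d] d assms S.subset by blast
  ultimately show ?thesis using ocompl_unique[of d y] S.ocompl_mem S.subset assms by auto
qed

text \<open>The cofactor \<open>r\<close> collects the remaining entries: if the tail sums to
  \<open>y \<boxplus> r\<close>, then \<open>(y \<boxplus> r) \<boxplus> a\<close> regroups to
  \<open>y \<boxplus> (r \<boxplus> a)\<close>.\<close>

lemma osum_list_member:
  "\<lbrakk>set as \<subseteq> carrier E; osum_list E as = Some s; y \<in> set as\<rbrakk>
    \<Longrightarrow> \<exists>r\<in>carrier E. osum E y r = Some s"
proof (induction as arbitrary: s)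
  case (Cons a as)
  obtain u where u: "osum_list E as = Some u" "osum E a u = Some s"
    using Cons.prems by (auto simp: bind_eq_Some_conv)
  have mem: "a \<in> carrier E" "u \<in> carrier E"
    using Cons.prems u osum_list_closed by auto
  show ?case
  proof (cases "y = a")
    case False
    then obtain r where r: "r \<in> carrier E" "osum E y r = Some u"
      using Cons u by auto
    have "osum E u a = Some s" using u mem osum_comm by blast
    then obtain f where "osum E r a = Some f" "osum E y f = Some s"
      using osum_assoc[of y r a u s] r mem Cons.prems by auto
    then show ?thesis using osum_closed[of r a f] r mem by blast
  qed (use u mem in blast)
qed simp

section \<open>Tests under rotation and merging\<close>

lemma tests_rotate: "as \<in> tests E n \<Longrightarrow> rotate i as \<in> tests E n"
proof (induction i)
  case (Suc i)
  have "rotate1 bs \<in> tests E n" if "bs \<in> tests E n" for bs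
    using that osum_list_snoc by (cases bs) (auto simp: tests_def simp del: osum_list.simps)
  then show ?case using Suc by simp
qed simp

lemma tests_merge:
  assumes "as \<in> tests E (n + 1)" "0 \<le> n"
  shows "merge_at E 0 as \<in> tests E n"
proof -
  obtain a b bs where as: "as = a # b # bs"
    using assms by (cases as; cases "tl as") (auto simp: tests_def)
  obtain c where "osum E a b = Some c" "c \<in> carrier E" "osum_list E (c # bs) = Some (oone E)"
    using assms osum_list_merge[of a b bs "oone E"] by (auto simp: as tests_def)
  then show ?thesis using assms by (auto simp: as tests_def merge_at_def simp del: osum_list.simps)
qed

lemma tests_rotate_last: "as \<in> tests E n \<Longrightarrow> last as # butlast as \<in> tests E n"
proof -
  assume as: "as \<in> tests E n"
  then have "as \<noteq> []" by (auto simp: tests_def)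
  then have "rotate (length (butlast as)) as = last as # butlast as"
    using rotate_append[of "butlast as" "[last as]"] by simp
  then show ?thesis using tests_rotate[OF as] by metis
qed

section \<open>The coboundary of a cyclic cochain as a sum over rotations\<close>

lemma cyclic_cochains_rotate:
  assumes "\<alpha> \<in> cyclic_cochains E (int n)" "as \<in> tests E (int n)"
  shows "\<alpha> (rotate i as) = (-1) ^ (n * i) * \<alpha> as"
proof (induction i)
  case (Suc i)
  let ?b = "rotate i as"
  have "?b \<noteq> []" using assms by (auto simp: tests_def)
  \<comment> \<open>Cyclicity is stated for moving the last entry to the front. Applied to
    \<open>rotate1 ?b\<close> it describes the rotation in the opposite direction.\<close>
  then have "last (rotate1 ?b) # butlast (rotate1 ?b) = ?b"
    by (cases ?b) auto
  moreover have "rotate1 ?b \<in> tests E (int n)" using tests_rotate[OF assms(2), of "Suc i"] by simp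
  ultimately have "\<alpha> (rotate1 ?b) = (-1) ^ n * \<alpha> ?b"
    using assms(1) by (auto simp: cyclic_cochains_def)
  then show ?case using Suc by (simp add: power_add)
qed simp

text \<open>On cyclic cochains every face operator, the last one included, is the front merge after a
  rotation, so that the coboundary becomes a signed sum over all rotations.\<close>

lemma coboundary_cyclic_eq:
  assumes \<alpha>: "\<alpha> \<in> cyclic_cochains E (int n)" and as: "as \<in> tests E (int n + 1)"
  shows "coboundary E (int n) \<alpha> as
    = (\<Sum>i<n + 2. (-1) ^ ((n + 1) * i) * \<alpha> (merge_at E 0 (rotate i as)))"
proof -
  have len: "length as = n + 2" using as by (simp add: tests_def)
  have "\<alpha> (merge_at E i as) = (-1) ^ (n * i) * \<alpha> (merge_at E 0 (rotate i as))" if "i \<le> n" for i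
  proof -
    let ?m = "merge_at E 0 (rotate i as)"
    have lm: "length (merge_at E i as) = n + 1" using len that by (simp add: merge_at_def)
    have r: "rotate i (merge_at E i as) = ?m" using len that by (intro rotate_merge_at) simp
    \<comment> \<open>The merged list has \<open>n + 1\<close> entries, so a full turn is the
      identity, and \<open>rotate (n + 1 - i)\<close> undoes the rotation that brought the pair to
      the front.\<close>
    have "merge_at E i as = rotate (n + 1) (merge_at E i as)"
      using lm rotate_id by (metis mod_self)
    also have "\<dots> = rotate (n + 1 - i) ?m" using that by (simp flip: r add: rotate_rotate)
    finally have "merge_at E i as = rotate (n + 1 - i) ?m" .
    moreover have "?m \<in> tests E (int n)" using as by (intro tests_merge tests_rotate) auto
    ultimately have "\<alpha> (merge_at E i as) = (-1) ^ (n * (n + 1 - i)) * \<alpha> ?m"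
      using cyclic_cochains_rotate[OF \<alpha>] by metis
    \<comment> \<open>Since \<open>n * (n + 1)\<close> is even, undoing the rotation costs the same
      sign as performing it. Together with the factor \<open>(-1) ^ i\<close> of the face this gives
      the exponent \<open>(n + 1) * i\<close>.\<close>
    moreover have "even (n * (n + 1 - i)) = even (n * i)" using that by auto
    ultimately show ?thesis by (simp add: minus_one_power_iff)
  qed
  then have "(\<Sum>i\<le>n. (-1) ^ i * \<alpha> (merge_at E i as))
      = (\<Sum>i<n + 1. (-1) ^ ((n + 1) * i) * \<alpha> (merge_at E 0 (rotate i as)))"
    by (intro sum.cong) (auto simp: power_add)
  \<comment> \<open>A number and its square have the same parity, so the wrap-around face is the
    summand of index \<open>n + 1\<close>.\<close>
  moreover have "(-1) ^ (n + 1) * \<alpha> (cyclic_merge E as)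
      = (-1) ^ ((n + 1) * (n + 1)) * \<alpha> (merge_at E 0 (rotate (n + 1) as))"
    unfolding cyclic_merge_rotate[OF len] by (simp add: minus_one_power_iff)
  ultimately show ?thesis using as by (simp add: coboundary_def)
qed

text \<open>Rotating the test by one shifts the index of the rotation sum and contributes the sign
  \<open>(-1) ^ (m + 1)\<close>. The summands have period \<open>m + 2\<close>, the number of terms,
  so the shift leaves the sum unchanged.\<close>

lemma coboundary_cyclic:
  assumes \<alpha>: "\<alpha> \<in> cyclic_cochains E n"
  shows "coboundary E n \<alpha> \<in> cyclic_cochains E (n + 1)"
proof (cases "n < 0")
  case True
  then have "coboundary E n \<alpha> = restrict (\<lambda>_. 0) (tests E (n + 1))"
    by (simp add: coboundary_def)
  then show ?thesis using tests_rotate_last by (simp add: cyclic_cochains_def)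
next
  case False
  define m where "m = nat n"
  have n: "n = int m" using False by (simp add: m_def)
  have "coboundary E n \<alpha> as = (-1) ^ nat (n + 1) * coboundary E n \<alpha> (last as # butlast as)"
    if as: "as \<in> tests E (n + 1)" for as
  proof -
    define b where "b = last as # butlast as"
    have "as \<noteq> []" and len: "length as = m + 2" using as by (auto simp: tests_def n)
    then have as_b: "as = rotate1 b" by (simp add: b_def)
    have b: "b \<in> tests E (n + 1)" unfolding b_def using as by (rule tests_rotate_last)
    define f where "f i = (-1) ^ ((m + 1) * i) * \<alpha> (merge_at E 0 (rotate i b))" for i
    have lb: "length b = m + 2" using len as_b by simp
    have "f (i + (m + 2)) = f i" for i
    proof -
      have "rotate (i + (m + 2)) b = rotate i b"
        using lb by (metis mod_add_self2 rotate_conv_mod)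
      \<comment> \<open>The sign has the same period as the rotation because
        \<open>(m + 1) * (m + 2)\<close> is even.\<close>
      moreover have "even ((m + 1) * (i + (m + 2))) = even ((m + 1) * i)" by auto
      ultimately show ?thesis by (simp only: f_def minus_one_power_iff)
    qed
    then have "(\<Sum>i<m + 2. f (i + 1)) = (\<Sum>i<m + 2. f i)" by (rule sum_shift_periodic)
    moreover have "(\<Sum>i<m + 2. f i) = coboundary E n \<alpha> b"
      using coboundary_cyclic_eq[of \<alpha> m b] \<alpha> b by (simp add: n f_def)
    moreover have "(\<Sum>i<m + 2. f (i + 1)) = (-1) ^ (m + 1) * coboundary E n \<alpha> as"
    proof -
      have "coboundary E n \<alpha> as
          = (\<Sum>i<m + 2. (-1) ^ ((m + 1) * i) * \<alpha> (merge_at E 0 (rotate i as)))"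
        using coboundary_cyclic_eq[of \<alpha> m as] \<alpha> as by (simp add: n)
      moreover have "f (i + 1) = (-1) ^ (m + 1) * ((-1) ^ ((m + 1) * i) * \<alpha> (merge_at E 0 (rotate i as)))"
        for i unfolding f_def as_b
        by (simp add: rotate1_rotate_swap power_add mult.assoc)
      ultimately show ?thesis by (simp only: sum_distrib_left)
    qed
    ultimately show ?thesis by (simp add: n b_def minus_one_power_iff nat_add_distrib split: if_splits)
  qed
  then show ?thesis by (auto simp: cyclic_cochains_def coboundary_def)
qed

text \<open>Merging two disjoint adjacent pairs, or an adjacent triple in two ways, gives the same cyclic
  word irrespective of the order.\<close>

lemma merge_rotate_merge:
  assumes \<alpha>: "\<alpha> \<in> cyclic_cochains E (int n)" and c: "c \<in> tests E (int n + 2)" and j: "j < n + 2"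
  shows "\<alpha> (merge_at E 0 (rotate (n + 1 - j) (merge_at E 0 (rotate (j + 1) c))))
    = (-1) ^ (n * j) * \<alpha> (merge_at E 0 (rotate j (merge_at E 0 c)))"
proof -
  have len: "length c = n + 3" using c by (simp add: tests_def)
  have "osum_list E (rotate i c) = Some (oone E)" "set (rotate i c) \<subseteq> carrier E" for i
    using tests_rotate[OF c, of i] by (auto simp: tests_def)
  note rot = this
  have assoc: "the (osum E x (the (osum E y z))) = the (osum E (the (osum E x y)) z)"
    if r: "rotate i c = x # y # z # us" for i x y z us
  proof -
    have mem: "x \<in> carrier E" "y \<in> carrier E" "z \<in> carrier E" "set us \<subseteq> carrier E"
      using rot[of i] r by auto
    obtain d where d: "osum E x y = Some d" "d \<in> carrier E" "osum_list E (d # z # us) = Some (oone E)"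
      using osum_list_merge[of x y "z # us" "oone E"] rot[of i, unfolded r] by blast
    have "set (d # z # us) \<subseteq> carrier E" using d mem by simp
    then obtain e where e: "osum E d z = Some e" using osum_list_merge d(3) by blast
    show ?thesis using osum_assoc[of x y z d e] d e mem by auto
  qed
  consider "j = 0" | "j = n + 1" | "0 < j" "j \<le> n" using j by linarith
  then show ?thesis
  proof cases
    \<comment> \<open>The overlapping case at the front: both orders merge the triple
      \<open>x\<close>, \<open>y\<close>, \<open>z\<close>, which leaves associativity only.\<close>
    case 1
    obtain x y z us where cc: "c = x # y # z # us" and us: "length us = n"
      using len by (metis Suc_length_conv add_Suc_right numeral_3_eq_3 add_0_right)
    have "rotate (n + 1) (the (osum E y z) # us @ [x]) = x # the (osum E y z) # us"
      using rotate_append[of "the (osum E y z) # us" "[x]"] us by simp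
    then show ?thesis using assoc[of 0 x y z us] by (simp add: 1 cc merge_at_def)
  next
    \<comment> \<open>The overlapping case across the end: the triple is \<open>w\<close>,
      \<open>x\<close>, \<open>y\<close> with \<open>w\<close> the last entry, and the sign exponent
      \<open>n * (n + 1)\<close> is even.\<close>
    case 2
    obtain x y us w where cc: "c = x # y # us @ [w]" and us: "length us = n"
      using len by (metis Suc_length_conv add_Suc_right numeral_3_eq_3 add_0_right length_Suc_conv_rev)
    have "rotate (n + 1) (the (osum E x y) # us @ [w]) = w # the (osum E x y) # us"
      using rotate_append[of "the (osum E x y) # us" "[w]"] us by simp
    moreover have rc: "rotate (n + 2) c = w # x # y # us"
      using rotate_append[of "x # y # us" "[w]"] us by (simp add: cc)
    moreover have "even (n * (n + 1))" by simp
    ultimately show ?thesis using assoc[OF rc] by (simp add: 2 cc merge_at_def minus_one_power_iff)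
  next
    \<comment> \<open>The disjoint pairs are \<open>x\<close>, \<open>y\<close> and
      \<open>z\<close>, \<open>w\<close>. One order of merging starts the resulting word at
      \<open>?p\<close>, the other at \<open>?q\<close>; the two words differ by a rotation by
      \<open>n + 1 - j\<close>, whose sign is \<open>(-1) ^ (n * j)\<close>.\<close>
    case 3
    obtain x y ds where c1: "c = x # y # ds" and ds: "length ds = n + 1"
      using len by (metis Suc_length_conv add_Suc_right numeral_3_eq_3 add_0_right Suc_eq_plus1)
    define us where "us = take (j - 1) ds"
    obtain z w vs where dr: "drop (j - 1) ds = z # w # vs"
    proof -
      have "length (drop (j - 1) ds) = Suc (Suc (n - j))" using ds 3 by simp
      then show thesis using that by (metis length_Suc_conv)
    qed
    have cc: "c = x # y # us @ z # w # vs"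
      unfolding c1 us_def by (simp flip: dr)
    have us: "Suc (length us) = j" using 3 ds by (simp add: us_def)
    then have vs: "length vs + j = n" using len by (simp add: cc)
    let ?p = "the (osum E x y)" and ?q = "the (osum E z w)"
    let ?R = "?q # vs @ ?p # us"
    have r1: "rotate j (merge_at E 0 c) = z # w # vs @ ?p # us"
      using rotate_append[of "?p # us" "z # w # vs"] us by (simp add: cc merge_at_def)
    have rc: "rotate (j + 1) c = z # w # vs @ x # y # us"
      using rotate_append[of "x # y # us" "z # w # vs"] by (simp add: cc flip: us)
    have nj: "n + 1 - j = length (?q # vs)" using vs by simp
    have "rotate (n + 1 - j) (merge_at E 0 (rotate (j + 1) c)) = x # y # us @ ?q # vs"
      using rotate_append[of "?q # vs" "x # y # us"] unfolding rc nj by (simp add: merge_at_def)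
    then have "merge_at E 0 (rotate (n + 1 - j) (merge_at E 0 (rotate (j + 1) c)))
        = ?p # us @ ?q # vs" by (simp add: merge_at_def)
    also have "\<dots> = rotate (n + 1 - j) ?R"
      using rotate_append[of "?q # vs" "?p # us"] unfolding nj by simp
    finally have lhs: "merge_at E 0 (rotate (n + 1 - j) (merge_at E 0 (rotate (j + 1) c)))
      = rotate (n + 1 - j) ?R" .
    have R: "merge_at E 0 (rotate j (merge_at E 0 c)) = ?R"
      unfolding r1 by (simp add: merge_at_def)
    have "?R \<in> tests E (int n)"
      using c unfolding R[symmetric] by (intro tests_merge tests_rotate) (auto simp: algebra_simps)
    then have "\<alpha> (rotate (n + 1 - j) ?R) = (-1) ^ (n * (n + 1 - j)) * \<alpha> ?R"
      by (rule cyclic_cochains_rotate[OF \<alpha>])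
    moreover have "even (n * (n + 1 - j)) = even (n * j)" using 3 by auto
    ultimately show ?thesis unfolding lhs R by (simp add: minus_one_power_iff)
  qed
qed

section \<open>Vanishing of the square of the coboundary\<close>

text \<open>Summing the cancellation \<open>anti\<close> over a full period in \<open>i\<close> and
  reflecting \<open>j\<close> shows that the double rotation sum equals its own negative.\<close>

lemma coboundary_coboundary:
  assumes \<alpha>: "\<alpha> \<in> cyclic_cochains E n"
  shows "coboundary E (n + 1) (coboundary E n \<alpha>) = restrict (\<lambda>_. 0) (tests E (n + 2))"
proof (rule ext)
  fix as
  show "coboundary E (n + 1) (coboundary E n \<alpha>) as = restrict (\<lambda>_. 0) (tests E (n + 2)) as"
  proof (cases "as \<in> tests E (n + 2)")
    case False
    then show ?thesis by (simp add: coboundary_def add.assoc)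
  next
    case as: True
    show ?thesis
    proof (cases "n < 0")
      case True
      show ?thesis
      \<comment> \<open>For \<open>n = -1\<close> the outer coboundary is given by the genuine
        formula in degree \<open>0\<close>, but it is applied to a zero cochain. In lower degrees it
        is zero by definition.\<close>
      proof (cases "n = -1")
        case True
        have "length as = 2" using as by (simp add: tests_def True)
        then have r: "coboundary E 0 (coboundary E (-1) \<alpha>) as =
            (\<Sum>i<0 + 2. (-1) ^ ((0 + 1) * i) * coboundary E (-1) \<alpha> (merge_at E 0 (rotate i as)))"
          using coboundary_cyclic_eq[of "coboundary E (-1) \<alpha>" 0 as] as coboundary_cyclic[OF \<alpha>]
          by (simp add: True)
        have "merge_at E 0 (rotate i as) \<in> tests E 0" for i
          using as by (intro tests_merge tests_rotate) (auto simp: True)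
        then have "coboundary E (-1) \<alpha> (merge_at E 0 (rotate i as)) = 0" for i
          by (simp add: coboundary_def)
        then show ?thesis using r as by (simp add: True)
      next
        case False
        then show ?thesis using as \<open>n < 0\<close> by (simp add: coboundary_def add.assoc)
      qed
    next
      case False
      define m where "m = nat n"
      have n: "n = int m" using False by (simp add: m_def)
      have len: "length as = m + 3" using as by (simp add: tests_def n)
      \<comment> \<open>The term that rotates by \<open>i\<close> and merges, then rotates by
        \<open>j\<close> and merges. The outer sign has exponent \<open>(m + 2) * i\<close>, which
        has the parity of \<open>m * i\<close>.\<close>
      define t where "t i j = (-1) ^ (m * i) * ((-1) ^ ((m + 1) * j)
          * \<alpha> (merge_at E 0 (rotate j (merge_at E 0 (rotate i as)))))" for i j
      have per: "t (i + (m + 3)) j = t i j" for i j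
      proof -
        have "rotate (i + (m + 3)) as = rotate i as"
          using len by (metis mod_add_self2 rotate_conv_mod)
        moreover have "even (m * (i + (m + 3))) = even (m * i)" by auto
        ultimately show ?thesis by (simp only: t_def minus_one_power_iff)
      qed
      have anti: "t i j = - t (i + (j + 1)) (m + 1 - j)" if j: "j < m + 2" for i j
      proof -
        have "\<alpha> (merge_at E 0 (rotate (m + 1 - j) (merge_at E 0 (rotate (i + (j + 1)) as))))
            = (-1) ^ (m * j) * \<alpha> (merge_at E 0 (rotate j (merge_at E 0 (rotate i as))))"
          using merge_rotate_merge[of \<alpha> m "rotate i as" j] \<alpha> tests_rotate[OF as, of i] j
          by (simp add: n rotate_rotate add.commute)
        moreover have "(-1) ^ (m * (i + (j + 1))) * ((-1) ^ ((m + 1) * (m + 1 - j)) * (-1) ^ (m * j))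
            = - ((-1) ^ (m * i) * (-1) ^ ((m + 1) * j) :: real)"
        proof -
          have "even (m * (i + (j + 1)) + ((m + 1) * (m + 1 - j) + m * j))
              = (\<not> even (m * i + (m + 1) * j))"
          proof -
            \<comment> \<open>Writing \<open>m + 1 = j + k\<close> expresses the parity of
              \<open>m\<close> by those of \<open>j\<close> and \<open>k\<close>; what remains is
              propositional in the parities of \<open>i\<close>, \<open>j\<close> and
              \<open>k\<close>.\<close>
            obtain k where k: "m + 1 = j + k" using j le_Suc_ex[of j "m + 1"] by auto
            then have mj: "m + 1 - j = k" by simp
            have "even m = (even j \<noteq> even k)" using k by presburger
            then show ?thesis unfolding mj by auto
          qed
          then show ?thesis unfolding power_add[symmetric] by (rule neg_one_power_opposite)
        qed
        ultimately show ?thesis unfolding t_def by (simp add: mult.assoc[symmetric])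
      qed
      have "coboundary E (n + 1) (coboundary E n \<alpha>) as = (\<Sum>i<m + 3. \<Sum>j<m + 2. t i j)"
      proof -
        have "coboundary E (n + 1) (coboundary E n \<alpha>) as
            = (\<Sum>i<m + 3. (-1) ^ ((m + 2) * i) * coboundary E n \<alpha> (merge_at E 0 (rotate i as)))"
          using coboundary_cyclic_eq[of "coboundary E n \<alpha>" "m + 1" as] as coboundary_cyclic[OF \<alpha>]
          by (simp add: n add.commute numeral_eq_Suc)
        moreover have "coboundary E n \<alpha> (merge_at E 0 (rotate i as)) =
          (\<Sum>j<m + 2. (-1) ^ ((m + 1) * j)
             * \<alpha> (merge_at E 0 (rotate j (merge_at E 0 (rotate i as)))))" for i
        proof -
          have "merge_at E 0 (rotate i as) \<in> tests E (n + 1)"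
            using as by (intro tests_merge tests_rotate) (auto simp: n algebra_simps)
          then show ?thesis using coboundary_cyclic_eq[of \<alpha> m] \<alpha> by (simp add: n)
        qed
        moreover have "(-1) ^ ((m + 2) * i) = ((-1) ^ (m * i) :: real)" for i
          by (simp add: minus_one_power_iff)
        ultimately show ?thesis by (simp only: t_def sum_distrib_left)
      qed
      moreover have "(\<Sum>i<m + 3. \<Sum>j<m + 2. t i j) = - (\<Sum>i<m + 3. \<Sum>j<m + 2. t i j)"
      proof -
        have "(\<Sum>i<m + 3. \<Sum>j<m + 2. t i j) = (\<Sum>j<m + 2. \<Sum>i<m + 3. t i j)"
          by (rule sum.swap)
        also have "\<dots> = (\<Sum>j<m + 2. \<Sum>i<m + 3. - t (i + (j + 1)) (m + 1 - j))"
          by (intro sum.cong refl anti) simp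
        also have "\<dots> = (\<Sum>j<m + 2. - (\<Sum>i<m + 3. t (i + (j + 1)) (m + 1 - j)))"
          by (simp only: sum_negf)
        also have "\<dots> = (\<Sum>j<m + 2. - (\<Sum>i<m + 3. t i (m + 1 - j)))"
          by (simp only: sum_shift_periodic[of "\<lambda>i. t i j" for j, OF per])
        \<comment> \<open>Here \<open>m + 1 - j\<close> is rewritten as
          \<open>m + 2 - Suc j\<close>, the form in which the reflection of an index range is
          stated.\<close>
        also have "\<dots> = - (\<Sum>j<m + 2. (\<Sum>i<m + 3. t i (m + 2 - Suc j)))"
          by (simp only: sum_negf) simp
        also have "\<dots> = - (\<Sum>j<m + 2. \<Sum>i<m + 3. t i j)"
          by (simp only: sum.nat_diff_reindex[of "\<lambda>j. \<Sum>i<m + 3. t i j"])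
        also have "(\<Sum>j<m + 2. \<Sum>i<m + 3. t i j) = (\<Sum>i<m + 3. \<Sum>j<m + 2. t i j)"
          by (rule sum.swap)
        finally show ?thesis .
      qed
      ultimately show ?thesis using as by simp
    qed
  qed
qed

end

section \<open>Quotients of vector spaces\<close>

lemma (in abelian_group) minus_eqI:
  "\<lbrakk>z \<oplus> y = x; x \<in> carrier G; y \<in> carrier G; z \<in> carrier G\<rbrakk> \<Longrightarrow> x \<ominus> y = z"
  by (auto simp: a_minus_def a_assoc r_neg)

lemma coset_carrier_update: "N +>\<^bsub>M\<lparr>carrier := Z\<rparr>\<^esub> x = N +>\<^bsub>M\<^esub> x"
  by (simp add: a_r_coset_def')

text \<open>Isolates the algebra of \<open>quot_module\<close> from cohomology; \<open>HC\<close> is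
  the instance of cocycles modulo coboundaries.\<close>

locale subspace_quotient =
  vectorspace K V for K (structure) and V (structure) +
  fixes N
  assumes submodule: "LinearCombinations.submodule K N V"
begin

sublocale abelian_subgroup N V
proof (rule abelian_subgroupI3)
  show "additive_subgroup N V"
  proof (rule additive_subgroupI, rule subgroup.intro)
    fix x assume "x \<in> N"
    moreover from this have "x \<in> carrier V" using submodule by (auto simp: submodule_def)
    \<comment> \<open>A submodule is not assumed closed under negation; this comes from scalar
      multiplication by \<open>-1\<close>.\<close>
    ultimately have "\<ominus>\<^bsub>V\<^esub> x \<in> N"
      using submodule smult_minus_1[of x]
      by (metis LinearCombinations.submodule.smult_closed R.add.inv_closed R.one_closed)
    then show "inv\<^bsub>add_monoid V\<^esub> x \<in> N" by (simp add: a_inv_def)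
  qed (use submodule in \<open>auto simp: submodule_def\<close>)
qed (rule M.abelian_group_axioms)

lemma carrier_quot: "carrier (quot_module V N) = (\<lambda>x. N +>\<^bsub>V\<^esub> x) ` carrier V"
  by (auto simp: quot_module_def A_RCOSETS_def')

lemma zero_quot: "\<zero>\<^bsub>quot_module V N\<^esub> = N +>\<^bsub>V\<^esub> \<zero>\<^bsub>V\<^esub>"
  using a_subset by (simp add: quot_module_def)

lemma add_quot:
  "\<lbrakk>x \<in> carrier V; y \<in> carrier V\<rbrakk> \<Longrightarrow>
    (N +>\<^bsub>V\<^esub> x) \<oplus>\<^bsub>quot_module V N\<^esub> (N +>\<^bsub>V\<^esub> y) = N +>\<^bsub>V\<^esub> (x \<oplus>\<^bsub>V\<^esub> y)"
  by (simp add: quot_module_def a_rcos_sum)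

lemma coset_eq_iff:
  assumes "x \<in> carrier V" "y \<in> carrier V"
  shows "N +>\<^bsub>V\<^esub> x = N +>\<^bsub>V\<^esub> y \<longleftrightarrow> x \<ominus>\<^bsub>V\<^esub> y \<in> N"
  using assms a_rcos_module[of y x] a_rcos_self[of x] a_repr_independence'[of x y]
  by (auto simp: a_minus_def)

text \<open>One inclusion absorbs the multiples of elements of \<open>N\<close> into
  \<open>N\<close>. The other uses the representative \<open>x\<close> itself, all of
  \<open>N\<close> being supplied by the added summand, also for the scalar
  \<open>0\<close>.\<close>

lemma smult_quot:
  assumes "c \<in> carrier K" "x \<in> carrier V"
  shows "c \<odot>\<^bsub>quot_module V N\<^esub> (N +>\<^bsub>V\<^esub> x) = N +>\<^bsub>V\<^esub> (c \<odot>\<^bsub>V\<^esub> x)"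
proof -
  let ?S = "N <+>\<^bsub>V\<^esub> (\<lambda>x. c \<odot>\<^bsub>V\<^esub> x) ` (N +>\<^bsub>V\<^esub> x)"
  have N: "n \<in> carrier V" "c \<odot>\<^bsub>V\<^esub> n \<in> N" if "n \<in> N" for n
    using submodule assms that by (auto simp: submodule_def)
  have "?S \<subseteq> N +>\<^bsub>V\<^esub> (c \<odot>\<^bsub>V\<^esub> x)"
  proof
    fix z assume "z \<in> ?S"
    then obtain n n' where n: "n \<in> N" "n' \<in> N" and z: "z = n \<oplus>\<^bsub>V\<^esub> c \<odot>\<^bsub>V\<^esub> (n' \<oplus>\<^bsub>V\<^esub> x)"
      by (auto simp: set_add_def' a_r_coset_def')
    have "z = (n \<oplus>\<^bsub>V\<^esub> c \<odot>\<^bsub>V\<^esub> n') \<oplus>\<^bsub>V\<^esub> c \<odot>\<^bsub>V\<^esub> x"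
      using n N assms by (simp add: z smult_r_distr M.a_ac)
    moreover have "n \<oplus>\<^bsub>V\<^esub> c \<odot>\<^bsub>V\<^esub> n' \<in> N" using n N by blast
    ultimately show "z \<in> N +>\<^bsub>V\<^esub> (c \<odot>\<^bsub>V\<^esub> x)" by (auto simp: a_r_coset_def')
  qed
  moreover have "N +>\<^bsub>V\<^esub> (c \<odot>\<^bsub>V\<^esub> x) \<subseteq> ?S"
  proof
    fix z assume "z \<in> N +>\<^bsub>V\<^esub> (c \<odot>\<^bsub>V\<^esub> x)"
    then obtain n where "n \<in> N" "z = n \<oplus>\<^bsub>V\<^esub> c \<odot>\<^bsub>V\<^esub> x" by (auto simp: a_r_coset_def')
    then show "z \<in> ?S" using a_rcos_self[OF assms(2)] unfolding set_add_def' by blast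
  qed
  ultimately show ?thesis by (simp add: quot_module_def)
qed

lemma vectorspace_quot: "vectorspace K (quot_module V N)"
proof (rule vs_criteria)
  show "field K" by (rule field_axioms)
  show "\<forall>X\<in>carrier (quot_module V N). \<exists>Y\<in>carrier (quot_module V N).
    X \<oplus>\<^bsub>quot_module V N\<^esub> Y = \<zero>\<^bsub>quot_module V N\<^esub>"
  proof
    fix X assume "X \<in> carrier (quot_module V N)"
    then obtain x where "x \<in> carrier V" "X = N +>\<^bsub>V\<^esub> x" by (auto simp: carrier_quot)
    then have "X \<oplus>\<^bsub>quot_module V N\<^esub> (N +>\<^bsub>V\<^esub> \<ominus>\<^bsub>V\<^esub> x) = \<zero>\<^bsub>quot_module V N\<^esub>"
      by (simp add: add_quot zero_quot M.r_neg)
    then show "\<exists>Y\<in>carrier (quot_module V N). X \<oplus>\<^bsub>quot_module V N\<^esub> Y = \<zero>\<^bsub>quot_module V N\<^esub>"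
      using \<open>x \<in> carrier V\<close> by (force simp: carrier_quot)
  qed
qed (auto simp: carrier_quot zero_quot add_quot smult_quot M.a_ac smult_l_distr smult_r_distr
      smult_assoc1)

end

section \<open>Cohomology classes\<close>

text \<open>One operation covers sums, differences, multiples and zero, so that each closure or
  compatibility property is proved once for all of them.\<close>

definition lin_comb2 :: "'b set \<Rightarrow> real \<Rightarrow> ('b \<Rightarrow> real) \<Rightarrow> real \<Rightarrow> ('b \<Rightarrow> real) \<Rightarrow> 'b \<Rightarrow> real" where
  "lin_comb2 T a \<alpha> b \<beta> = (\<lambda>v\<in>T. a * \<alpha> v + b * \<beta> v)"

lemma lin_comb2_apply: "v \<in> T \<Longrightarrow> lin_comb2 T a \<alpha> b \<beta> v = a * \<alpha> v + b * \<beta> v"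
  by (simp add: lin_comb2_def)

lemma lin_comb2_diff_add:
  "\<alpha> \<in> extensional T \<Longrightarrow> lin_comb2 T 1 (lin_comb2 T 1 \<alpha> (-1) \<beta>) 1 \<beta> = \<alpha>"
  by (auto simp: lin_comb2_def restrict_def extensional_def)

lemma cochains_ops_lin_comb2:
  "\<alpha> \<oplus>\<^bsub>cochains E n\<^esub> \<beta> = lin_comb2 (tests E n) 1 \<alpha> 1 \<beta>"
  "c \<odot>\<^bsub>cochains E n\<^esub> \<alpha> = lin_comb2 (tests E n) c \<alpha> 0 \<alpha>"
  "\<zero>\<^bsub>cochains E n\<^esub> = lin_comb2 (tests E n) 0 \<alpha> 0 \<alpha>"
  by (auto simp: lin_comb2_def)

lemma vectorspace_cochains: "vectorspace class_ring (cochains E n)"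
proof (rule vs_criteria)
  show "\<forall>v\<in>carrier (cochains E n).
    \<exists>neg_v\<in>carrier (cochains E n). v \<oplus>\<^bsub>cochains E n\<^esub> neg_v = \<zero>\<^bsub>cochains E n\<^esub>"
  proof
    fix v show "\<exists>w\<in>carrier (cochains E n). v \<oplus>\<^bsub>cochains E n\<^esub> w = \<zero>\<^bsub>cochains E n\<^esub>"
      by (rule bexI[of _ "\<lambda>as\<in>tests E n. - v as"]) auto
  qed
qed (auto simp: class_field fun_eq_iff PiE_iff extensional_def algebra_simps)

lemma submodule_cochainsI:
  assumes "N \<subseteq> tests E n \<rightarrow>\<^sub>E UNIV" "N \<noteq> {}"
    and "\<And>a b \<alpha> \<beta>. \<lbrakk>\<alpha> \<in> N; \<beta> \<in> N\<rbrakk> \<Longrightarrow> lin_comb2 (tests E n) a \<alpha> b \<beta> \<in> N"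
  shows "LinearCombinations.submodule class_ring N (cochains E n)"
proof (rule LinearCombinations.submodule.intro)
  show "module class_ring (cochains E n)"
    using vectorspace_cochains[of E n] by (simp add: vectorspace_def)
  obtain \<alpha> where "\<alpha> \<in> N" using assms(2) by blast
  then show "\<zero>\<^bsub>cochains E n\<^esub> \<in> N"
    using assms(3)[of \<alpha> \<alpha> 0 0] by (simp only: cochains_ops_lin_comb2(3)[of E n \<alpha>])
  show "\<alpha> \<oplus>\<^bsub>cochains E n\<^esub> \<beta> \<in> N" if "\<alpha> \<in> N" "\<beta> \<in> N" for \<alpha> \<beta>
    using that assms(3) by (simp only: cochains_ops_lin_comb2)
  show "c \<odot>\<^bsub>cochains E n\<^esub> \<alpha> \<in> N" if "\<alpha> \<in> N" for \<alpha> c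
    using that assms(3) by (simp only: cochains_ops_lin_comb2)
qed (use assms(1) in simp)

context effect_algebra
begin

section \<open>Cocycles and coboundaries under linear combinations\<close>

text \<open>A rotation turns this face into the front merge of a rotated test, and tests are stable
  under rotation.\<close>

lemma tests_merge_at:
  assumes "as \<in> tests E (n + 1)" "0 \<le> n" "i \<le> nat n"
  shows "merge_at E i as \<in> tests E n"
proof -
  have len: "length as = nat n + 2" using assms unfolding tests_def mem_Collect_eq by linarith
  have lm: "length (merge_at E i as) = nat n + 1" using len assms by (simp add: merge_at_def)
  have "rotate (nat n + 1 - i) (rotate i (merge_at E i as)) = rotate (nat n + 1) (merge_at E i as)"
    using assms(3) by (simp add: rotate_rotate del: rotate_Suc)
  also have "\<dots> = merge_at E i as" using lm by (metis mod_self rotate_id)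
  finally have "rotate (nat n + 1 - i) (rotate i (merge_at E i as)) = merge_at E i as" .
  moreover have "rotate i (merge_at E i as) \<in> tests E n"
    using len assms rotate_merge_at[of i as E] tests_merge tests_rotate by (metis (no_types, lifting)
        add_2_eq_Suc' le_imp_less_Suc Suc_le_mono not_less_eq_eq less_Suc_eq_le)
  ultimately show ?thesis using tests_rotate by metis
qed

lemma tests_cyclic_merge:
  assumes "as \<in> tests E (n + 1)" "0 \<le> n"
  shows "cyclic_merge E as \<in> tests E n"
proof -
  have "length as = nat n + 2" using assms unfolding tests_def mem_Collect_eq by linarith
  from cyclic_merge_rotate[OF this] show ?thesis using assms tests_merge tests_rotate by metis
qed

text \<open>All faces of a test are tests, so the coboundary reads a cochain on tests only.
  Restrictions can thus be dropped or inserted under it.\<close>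

lemma coboundary_cong:
  assumes "\<And>as. as \<in> tests E n \<Longrightarrow> \<alpha> as = \<beta> as"
  shows "coboundary E n \<alpha> = coboundary E n \<beta>"
  using assms tests_merge_at[of _ n] tests_cyclic_merge[of _ n]
  by (auto simp: coboundary_def fun_eq_iff restrict_def intro!: sum.cong)

lemma coboundary_lin_comb2:
  "coboundary E n (lin_comb2 (tests E n) a \<alpha> b \<beta>)
    = lin_comb2 (tests E (n + 1)) a (coboundary E n \<alpha>) b (coboundary E n \<beta>)"
proof -
  have "coboundary E n (lin_comb2 (tests E n) a \<alpha> b \<beta>) = coboundary E n (\<lambda>v. a * \<alpha> v + b * \<beta> v)"
    by (intro coboundary_cong) (simp add: lin_comb2_apply)
  also have "\<dots> = lin_comb2 (tests E (n + 1)) a (coboundary E n \<alpha>) b (coboundary E n \<beta>)"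
    by (auto simp: coboundary_def lin_comb2_def fun_eq_iff restrict_def algebra_simps sum.distrib
        sum_distrib_left)
  finally show ?thesis .
qed

lemma cyclic_cochains_lin_comb2:
  assumes "\<alpha> \<in> cyclic_cochains E n" "\<beta> \<in> cyclic_cochains E n"
  shows "lin_comb2 (tests E n) a \<alpha> b \<beta> \<in> cyclic_cochains E n"
proof -
  have "lin_comb2 (tests E n) a \<alpha> b \<beta> as
      = (-1) ^ nat n * lin_comb2 (tests E n) a \<alpha> b \<beta> (last as # butlast as)"
    if as: "as \<in> tests E n" for as
  proof -
    define s where "s = ((-1) ^ nat n :: real)"
    have "\<alpha> as = s * \<alpha> (last as # butlast as)" "\<beta> as = s * \<beta> (last as # butlast as)"
      using assms as by (auto simp: cyclic_cochains_def s_def)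
    then show ?thesis using as tests_rotate_last[OF as]
      by (simp add: lin_comb2_apply algebra_simps flip: s_def)
  qed
  then show ?thesis by (auto simp: cyclic_cochains_def lin_comb2_def)
qed

lemma zero_cyclic_cochains: "(\<lambda>_\<in>tests E n. 0) \<in> cyclic_cochains E n"
  by (auto simp: cyclic_cochains_def tests_rotate_last)

lemma cyclic_cocyclesI:
  assumes "\<alpha> \<in> cyclic_cochains E n" "\<And>as. as \<in> tests E (n + 1) \<Longrightarrow> coboundary E n \<alpha> as = 0"
  shows "\<alpha> \<in> cyclic_cocycles E n"
  using assms by (auto simp: cyclic_cocycles_def coboundary_def fun_eq_iff restrict_def)

lemma cyclic_cocyclesD:
  assumes "\<alpha> \<in> cyclic_cocycles E n"
  shows "\<alpha> \<in> cyclic_cochains E n" "as \<in> tests E (n + 1) \<Longrightarrow> coboundary E n \<alpha> as = 0"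
  using assms by (auto simp: cyclic_cocycles_def)

lemma cyclic_cocycles_ext: "\<alpha> \<in> cyclic_cocycles E n \<Longrightarrow> \<alpha> \<in> extensional (tests E n)"
  by (auto simp: cyclic_cocycles_def cyclic_cochains_def PiE_iff)

lemma cyclic_cocycles_lin_comb2:
  assumes "\<alpha> \<in> cyclic_cocycles E n" "\<beta> \<in> cyclic_cocycles E n"
  shows "lin_comb2 (tests E n) a \<alpha> b \<beta> \<in> cyclic_cocycles E n"
  using assms by (intro cyclic_cocyclesI)
    (auto simp: cyclic_cochains_lin_comb2 coboundary_lin_comb2 lin_comb2_apply cyclic_cocyclesD)

lemma cyclic_coboundaries_lin_comb2:
  assumes "\<alpha> \<in> cyclic_coboundaries E n" "\<beta> \<in> cyclic_coboundaries E n"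
  shows "lin_comb2 (tests E n) a \<alpha> b \<beta> \<in> cyclic_coboundaries E n"
proof -
  obtain \<alpha>' \<beta>' where "\<alpha>' \<in> cyclic_cochains E (n - 1)" "\<alpha> = coboundary E (n - 1) \<alpha>'"
    "\<beta>' \<in> cyclic_cochains E (n - 1)" "\<beta> = coboundary E (n - 1) \<beta>'"
    using assms by (auto simp: cyclic_coboundaries_def)
  then show ?thesis
    using coboundary_lin_comb2[of "n - 1" a \<alpha>' b \<beta>'] cyclic_cochains_lin_comb2[of \<alpha>' "n - 1" \<beta>' a b]
    unfolding cyclic_coboundaries_def by (metis diff_add_cancel imageI)
qed

text \<open>The zero cochain is written with coefficients \<open>0\<close> and an arbitrary
  \<open>\<alpha>\<close>, so that the rules for \<open>lin_comb2\<close> apply to it.\<close>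

lemma zero_cyclic_coboundaries:
  "lin_comb2 (tests E n) 0 \<alpha> 0 \<alpha> \<in> cyclic_coboundaries E n"
proof -
  have "coboundary E (n - 1) (\<lambda>_\<in>tests E (n - 1). 0) \<in> cyclic_coboundaries E n" (is "?z \<in> _")
    unfolding cyclic_coboundaries_def by (intro imageI zero_cyclic_cochains)
  then have "lin_comb2 (tests E n) 0 ?z 0 ?z \<in> cyclic_coboundaries E n"
    by (intro cyclic_coboundaries_lin_comb2)
  then show ?thesis by (simp add: lin_comb2_def)
qed

lemma cyclic_coboundaries_subset: "cyclic_coboundaries E n \<subseteq> cyclic_cocycles E n"
proof
  fix \<beta> assume "\<beta> \<in> cyclic_coboundaries E n"
  then obtain \<alpha> where "\<alpha> \<in> cyclic_cochains E (n - 1)" "\<beta> = coboundary E (n - 1) \<alpha>"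
    by (auto simp: cyclic_coboundaries_def)
  then show "\<beta> \<in> cyclic_cocycles E n"
    using coboundary_cyclic[of \<alpha> "n - 1"] coboundary_coboundary[of \<alpha> "n - 1"]
    by (intro cyclic_cocyclesI) (auto simp: add.commute)
qed

lemma submodule_cyclic_cocycles:
  "LinearCombinations.submodule class_ring (cyclic_cocycles E n) (cochains E n)"
proof (rule submodule_cochainsI)
  have "coboundary E n (\<lambda>_\<in>tests E n. 0) = coboundary E n (lin_comb2 (tests E n) 0 (\<lambda>_. 0) 0 (\<lambda>_. 0))"
    by (intro coboundary_cong) (simp add: lin_comb2_apply)
  then have "(\<lambda>_\<in>tests E n. 0) \<in> cyclic_cocycles E n"
    by (intro cyclic_cocyclesI zero_cyclic_cochains)
      (simp add: coboundary_lin_comb2 lin_comb2_apply)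
  then show "cyclic_cocycles E n \<noteq> {}" by blast
qed (use cyclic_cocycles_lin_comb2 in \<open>auto simp: cyclic_cocycles_def cyclic_cochains_def\<close>)

lemma subspace_quotient_HC:
  "subspace_quotient class_ring ((cochains E n)\<lparr>carrier := cyclic_cocycles E n\<rparr>)
     (cyclic_coboundaries E n)" (is "subspace_quotient _ ?V ?B")
proof -
  interpret C: vectorspace class_ring "cochains E n" by (rule vectorspace_cochains)
  have V: "vectorspace class_ring ?V"
    using submodule_cyclic_cocycles C.submodule_is_module class_field by (simp add: vectorspace_def)
  have B: "?B \<noteq> {}" using zero_cyclic_cochains by (auto simp: cyclic_coboundaries_def)
  have sub: "?B \<subseteq> tests E n \<rightarrow>\<^sub>E UNIV"
    using cyclic_coboundaries_subset by (auto simp: cyclic_cocycles_def cyclic_cochains_def)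
  have "LinearCombinations.submodule class_ring ?B (cochains E n)"
    using B sub cyclic_coboundaries_lin_comb2 by (intro submodule_cochainsI) auto
  then have "LinearCombinations.submodule class_ring ?B ?V"
    using V cyclic_coboundaries_subset
    by (auto simp: LinearCombinations.submodule_def vectorspace_def)
  then show ?thesis using V by (simp add: subspace_quotient_def subspace_quotient_axioms_def)
qed

end

section \<open>Classes of cocycles\<close>

text \<open>The coset is formed in the full cochain space, as in \<open>HC_restrict\<close>;
  \<open>coset_carrier_update\<close> identifies it with the coset in the space of cocycles that
  \<open>HC\<close> uses.\<close>

definition HC_class ::
  "('a, 'm) effect_algebra_scheme \<Rightarrow> int \<Rightarrow> ('a list \<Rightarrow> real) \<Rightarrow> ('a list \<Rightarrow> real) set" where
  "HC_class E n \<alpha> = cyclic_coboundaries E n +>\<^bsub>cochains E n\<^esub> \<alpha>"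

context effect_algebra
begin

lemma vectorspace_HC: "vectorspace class_ring (HC E n)"
  using subspace_quotient.vectorspace_quot[OF subspace_quotient_HC] by (simp add: HC_def)

lemma carrier_HC: "carrier (HC E n) = HC_class E n ` cyclic_cocycles E n"
  using subspace_quotient.carrier_quot[OF subspace_quotient_HC]
  by (simp add: HC_def HC_class_def coset_carrier_update)

lemma HC_class_eq_iff:
  assumes "\<alpha> \<in> cyclic_cocycles E n" "\<beta> \<in> cyclic_cocycles E n"
  shows "HC_class E n \<alpha> = HC_class E n \<beta>
    \<longleftrightarrow> lin_comb2 (tests E n) 1 \<alpha> (-1) \<beta> \<in> cyclic_coboundaries E n"
proof -
  let ?V = "(cochains E n)\<lparr>carrier := cyclic_cocycles E n\<rparr>"
  interpret Q: subspace_quotient class_ring ?V "cyclic_coboundaries E n"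
    by (rule subspace_quotient_HC)
  let ?d = "lin_comb2 (tests E n) 1 \<alpha> (-1) \<beta>"
  have "?d \<oplus>\<^bsub>?V\<^esub> \<beta> = \<alpha>"
    using lin_comb2_diff_add[OF cyclic_cocycles_ext[OF assms(1)], of \<beta>]
    by (simp add: lin_comb2_def)
  then have "\<alpha> \<ominus>\<^bsub>?V\<^esub> \<beta> = ?d"
    by (rule Q.M.minus_eqI) (use assms cyclic_cocycles_lin_comb2 in simp_all)
  then show ?thesis
    using Q.coset_eq_iff[of \<alpha> \<beta>] assms by (simp add: HC_class_def coset_carrier_update)
qed

lemma HC_class_add:
  assumes "\<alpha> \<in> cyclic_cocycles E n" "\<beta> \<in> cyclic_cocycles E n"
  shows "HC_class E n \<alpha> \<oplus>\<^bsub>HC E n\<^esub> HC_class E n \<beta> = HC_class E n (lin_comb2 (tests E n) 1 \<alpha> 1 \<beta>)"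
  using subspace_quotient.add_quot[OF subspace_quotient_HC, of \<alpha> n \<beta>] assms
  by (simp add: HC_def HC_class_def coset_carrier_update lin_comb2_def)

lemma HC_class_smult:
  assumes "\<alpha> \<in> cyclic_cocycles E n"
  shows "c \<odot>\<^bsub>HC E n\<^esub> HC_class E n \<alpha> = HC_class E n (lin_comb2 (tests E n) c \<alpha> 0 \<alpha>)"
  using subspace_quotient.smult_quot[OF subspace_quotient_HC, of c \<alpha> n] assms
  by (simp add: HC_def HC_class_def coset_carrier_update lin_comb2_def)

lemma HC_class_zero_iff:
  assumes "\<alpha> \<in> cyclic_cocycles E n"
  shows "HC_class E n \<alpha> = \<zero>\<^bsub>HC E n\<^esub> \<longleftrightarrow> \<alpha> \<in> cyclic_coboundaries E n"
proof -
  let ?z = "lin_comb2 (tests E n) 0 \<alpha> 0 \<alpha>"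
  have "\<zero>\<^bsub>HC E n\<^esub> = HC_class E n ?z"
    using subspace_quotient.zero_quot[OF subspace_quotient_HC, of n]
    by (simp add: HC_def HC_class_def coset_carrier_update lin_comb2_def)
  moreover have "lin_comb2 (tests E n) 1 \<alpha> (-1) ?z = \<alpha>"
    using cyclic_cocycles_ext[OF assms] by (auto simp: lin_comb2_def restrict_def extensional_def)
  ultimately show ?thesis
    using HC_class_eq_iff[OF assms cyclic_cocycles_lin_comb2[OF assms assms]] by simp
qed

lemma HC_class_diff:
  assumes "\<alpha> \<in> cyclic_cocycles E n" "\<beta> \<in> cyclic_cocycles E n"
  shows "HC_class E n \<alpha> \<ominus>\<^bsub>HC E n\<^esub> HC_class E n \<beta> = HC_class E n (lin_comb2 (tests E n) 1 \<alpha> (-1) \<beta>)"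
proof -
  let ?d = "lin_comb2 (tests E n) 1 \<alpha> (-1) \<beta>"
  interpret H: vectorspace class_ring "HC E n" by (rule vectorspace_HC)
  have d: "?d \<in> cyclic_cocycles E n" using assms by (rule cyclic_cocycles_lin_comb2)
  have "lin_comb2 (tests E n) 1 ?d 1 \<beta> = \<alpha>"
    using cyclic_cocycles_ext[OF assms(1)] by (rule lin_comb2_diff_add)
  then show ?thesis using assms d
    by (intro H.M.minus_eqI) (auto simp: HC_class_add carrier_HC)
qed

text \<open>Every element of \<open>HC E n\<close> is the class of a cocycle, so linearity can be
  tested on classes of cocycles.\<close>

lemma linear_map_HCI:
  assumes W: "vectorspace class_ring W"
    and carr: "\<And>\<alpha>. \<alpha> \<in> cyclic_cocycles E n \<Longrightarrow> g (HC_class E n \<alpha>) \<in> carrier W"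
    and add: "\<And>\<alpha> \<beta>. \<lbrakk>\<alpha> \<in> cyclic_cocycles E n; \<beta> \<in> cyclic_cocycles E n\<rbrakk> \<Longrightarrow>
      g (HC_class E n (lin_comb2 (tests E n) 1 \<alpha> 1 \<beta>))
        = g (HC_class E n \<alpha>) \<oplus>\<^bsub>W\<^esub> g (HC_class E n \<beta>)"
    and smult: "\<And>\<alpha> c. \<alpha> \<in> cyclic_cocycles E n \<Longrightarrow>
      g (HC_class E n (lin_comb2 (tests E n) c \<alpha> 0 \<alpha>)) = c \<odot>\<^bsub>W\<^esub> g (HC_class E n \<alpha>)"
  shows "linear_map class_ring (HC E n) W g"
proof -
  have "g \<in> LinearCombinations.module_hom class_ring (HC E n) W"
    using carr by (auto simp: LinearCombinations.module_hom_def carrier_HC HC_class_add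
        HC_class_smult add smult)
  then show ?thesis using W vectorspace_HC
    by (simp add: linear_map_def mod_hom_def mod_hom_axioms_def vectorspace_def)
qed

end

section \<open>Restriction to subalgebras\<close>

lemma osum_list_carrier_update [simp]: "osum_list (E\<lparr>carrier := A\<rparr>) as = osum_list E as"
  by (induction as) auto

lemma merge_carrier_update [simp]:
  "merge_at (E\<lparr>carrier := A\<rparr>) = merge_at E"
  "cyclic_merge (E\<lparr>carrier := A\<rparr>) = cyclic_merge E"
  by (simp_all add: merge_at_def cyclic_merge_def fun_eq_iff)

lemma coboundary_ext: "coboundary E n \<alpha> \<in> extensional (tests E (n + 1))"
  by (simp add: coboundary_def)

context effect_algebra
begin

lemma tests_subalgebra:
  assumes "effect_subalgebra A E"
  shows "tests (E\<lparr>carrier := A\<rparr>) n = {as \<in> tests E n. set as \<subseteq> A}"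
  using effect_subalgebra.subset[OF assms] by (auto simp: tests_def)

lemma cyclic_cochains_restrict:
  assumes A: "effect_subalgebra A E" and \<alpha>: "\<alpha> \<in> cyclic_cochains E n"
  shows "restrict \<alpha> (tests (E\<lparr>carrier := A\<rparr>) n) \<in> cyclic_cochains (E\<lparr>carrier := A\<rparr>) n"
proof -
  interpret A: effect_algebra "E\<lparr>carrier := A\<rparr>" by (rule subalgebra_is_effect_algebra[OF A])
  show ?thesis using \<alpha> A.tests_rotate_last tests_subalgebra[OF A]
    by (auto simp: cyclic_cochains_def)
qed

text \<open>The faces of a test of \<open>A\<close> are tests of \<open>A\<close> and are formed as
  in \<open>E\<close>, so both sides read the same values. With two cochains, a cochain on
  \<open>A\<close> can be compared with one on \<open>E\<close> that agrees with it on tests of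
  \<open>A\<close> only.\<close>

lemma coboundary_subalgebra:
  assumes A: "effect_subalgebra A E" and as: "as \<in> tests (E\<lparr>carrier := A\<rparr>) (n + 1)"
    and eq: "\<And>bs. bs \<in> tests (E\<lparr>carrier := A\<rparr>) n \<Longrightarrow> \<alpha> bs = \<beta> bs"
  shows "coboundary (E\<lparr>carrier := A\<rparr>) n \<alpha> as = coboundary E n \<beta> as"
proof -
  interpret A: effect_algebra "E\<lparr>carrier := A\<rparr>" by (rule subalgebra_is_effect_algebra[OF A])
  have "coboundary (E\<lparr>carrier := A\<rparr>) n \<alpha> as = coboundary (E\<lparr>carrier := A\<rparr>) n \<beta> as"
    using A.coboundary_cong[OF eq] by simp
  also have "\<dots> = coboundary E n \<beta> as"
    using as tests_subalgebra[OF A] by (simp add: coboundary_def)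
  finally show ?thesis .
qed

lemma cyclic_coboundariesI:
  assumes "\<omega> \<in> cyclic_cochains E (n - 1)" "\<alpha> \<in> extensional (tests E n)"
    and "\<And>as. as \<in> tests E n \<Longrightarrow> \<alpha> as = coboundary E (n - 1) \<omega> as"
  shows "\<alpha> \<in> cyclic_coboundaries E n"
proof -
  have "\<alpha> = coboundary E (n - 1) \<omega>"
    using assms coboundary_ext[of E "n - 1" \<omega>] by (intro extensionalityI[of _ "tests E n"]) auto
  then show ?thesis using assms(1) by (auto simp: cyclic_coboundaries_def)
qed

lemma coboundary_cyclic_pred:
  "\<omega> \<in> cyclic_cochains E (n - 1) \<Longrightarrow> coboundary E (n - 1) \<omega> \<in> cyclic_cochains E n"
  using coboundary_cyclic[of \<omega> "n - 1"] by simp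

lemma coboundary_coboundary_apply:
  "\<lbrakk>\<omega> \<in> cyclic_cochains E (n - 1); as \<in> tests E (n + 1)\<rbrakk> \<Longrightarrow>
    coboundary E n (coboundary E (n - 1) \<omega>) as = 0"
  using coboundary_coboundary[of \<omega> "n - 1"] by (simp add: add.commute)

lemma cyclic_cocycles_restrict:
  assumes A: "effect_subalgebra A E" and \<alpha>: "\<alpha> \<in> cyclic_cocycles E n"
  shows "restrict \<alpha> (tests (E\<lparr>carrier := A\<rparr>) n) \<in> cyclic_cocycles (E\<lparr>carrier := A\<rparr>) n"
proof -
  interpret A: effect_algebra "E\<lparr>carrier := A\<rparr>" by (rule subalgebra_is_effect_algebra[OF A])
  show ?thesis
  proof (rule A.cyclic_cocyclesI)
    show "restrict \<alpha> (tests (E\<lparr>carrier := A\<rparr>) n) \<in> cyclic_cochains (E\<lparr>carrier := A\<rparr>) n"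
      using A cyclic_cocyclesD(1)[OF \<alpha>] by (rule cyclic_cochains_restrict)
    fix as assume as: "as \<in> tests (E\<lparr>carrier := A\<rparr>) (n + 1)"
    have "coboundary (E\<lparr>carrier := A\<rparr>) n (restrict \<alpha> (tests (E\<lparr>carrier := A\<rparr>) n)) as
        = coboundary E n \<alpha> as"
      using A as by (rule coboundary_subalgebra) simp
    also have "\<dots> = 0" using as tests_subalgebra[OF A] cyclic_cocyclesD(2)[OF \<alpha>] by simp
    finally show "coboundary (E\<lparr>carrier := A\<rparr>) n
      (restrict \<alpha> (tests (E\<lparr>carrier := A\<rparr>) n)) as = 0" .
  qed
qed

lemma cyclic_coboundaries_restrict:
  assumes A: "effect_subalgebra A E" and \<alpha>: "\<alpha> \<in> cyclic_coboundaries E n"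
  shows "restrict \<alpha> (tests (E\<lparr>carrier := A\<rparr>) n) \<in> cyclic_coboundaries (E\<lparr>carrier := A\<rparr>) n"
proof -
  interpret A: effect_algebra "E\<lparr>carrier := A\<rparr>" by (rule subalgebra_is_effect_algebra[OF A])
  obtain \<omega> where \<omega>: "\<omega> \<in> cyclic_cochains E (n - 1)" "\<alpha> = coboundary E (n - 1) \<omega>"
    using \<alpha> by (auto simp: cyclic_coboundaries_def)
  show ?thesis
  proof (rule A.cyclic_coboundariesI)
    show "restrict \<omega> (tests (E\<lparr>carrier := A\<rparr>) (n - 1)) \<in> cyclic_cochains (E\<lparr>carrier := A\<rparr>) (n - 1)"
      using A \<omega>(1) by (rule cyclic_cochains_restrict)
    fix as assume "as \<in> tests (E\<lparr>carrier := A\<rparr>) n"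
    then show "restrict \<alpha> (tests (E\<lparr>carrier := A\<rparr>) n) as = coboundary (E\<lparr>carrier := A\<rparr>) (n - 1)
        (restrict \<omega> (tests (E\<lparr>carrier := A\<rparr>) (n - 1))) as"
      using coboundary_subalgebra[OF A, of as "n - 1"
          "restrict \<omega> (tests (E\<lparr>carrier := A\<rparr>) (n - 1))" \<omega>] by (simp add: \<omega>(2))
  qed simp
qed

lemma restrict_lin_comb2:
  assumes "effect_subalgebra A E"
  shows "restrict (lin_comb2 (tests E n) a \<alpha> b \<beta>) (tests (E\<lparr>carrier := A\<rparr>) n)
    = lin_comb2 (tests (E\<lparr>carrier := A\<rparr>) n) a (restrict \<alpha> (tests (E\<lparr>carrier := A\<rparr>) n))
        b (restrict \<beta> (tests (E\<lparr>carrier := A\<rparr>) n))"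
  using tests_subalgebra[OF assms] by (auto simp: lin_comb2_def restrict_def)

text \<open>Restriction preserves coboundaries, so all representatives yield the same coset. The
  union defining \<open>HC_restrict\<close> is then that coset, provided there is at least one
  representative.\<close>

lemma HC_restrict_class:
  assumes A: "effect_subalgebra A E" and \<alpha>: "\<alpha> \<in> cyclic_cocycles E n"
  shows "HC_restrict (E\<lparr>carrier := A\<rparr>) n (HC_class E n \<alpha>)
    = HC_class (E\<lparr>carrier := A\<rparr>) n (restrict \<alpha> (tests (E\<lparr>carrier := A\<rparr>) n))"
proof -
  interpret A: effect_algebra "E\<lparr>carrier := A\<rparr>" by (rule subalgebra_is_effect_algebra[OF A])
  let ?r = "\<lambda>\<beta>. restrict \<beta> (tests (E\<lparr>carrier := A\<rparr>) n)"
  have "HC_class (E\<lparr>carrier := A\<rparr>) n (?r \<beta>) = HC_class (E\<lparr>carrier := A\<rparr>) n (?r \<alpha>)"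
    if mem: "\<beta> \<in> HC_class E n \<alpha>" for \<beta>
  proof -
    obtain \<epsilon> where \<epsilon>: "\<epsilon> \<in> cyclic_coboundaries E n" and \<beta>: "\<beta> = lin_comb2 (tests E n) 1 \<epsilon> 1 \<alpha>"
      using mem by (auto simp: HC_class_def a_r_coset_def' lin_comb2_def)
    have "\<beta> \<in> cyclic_cocycles E n"
      using \<epsilon> \<alpha> cyclic_coboundaries_subset cyclic_cocycles_lin_comb2 unfolding \<beta> by blast
    moreover have "lin_comb2 (tests (E\<lparr>carrier := A\<rparr>) n) 1 (?r \<beta>) (-1) (?r \<alpha>) = ?r \<epsilon>"
      using tests_subalgebra[OF A] by (auto simp: \<beta> lin_comb2_def restrict_def)
    ultimately show ?thesis
      using A.HC_class_eq_iff[of "?r \<beta>" n "?r \<alpha>"] cyclic_cocycles_restrict[OF A] \<alpha>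
        cyclic_coboundaries_restrict[OF A \<epsilon>] by simp
  qed
  moreover have "HC_class E n \<alpha> \<noteq> {}"
  proof -
    interpret Q: subspace_quotient class_ring "(cochains E n)\<lparr>carrier := cyclic_cocycles E n\<rparr>"
      "cyclic_coboundaries E n" by (rule subspace_quotient_HC)
    show ?thesis using Q.a_rcos_self[of \<alpha>] \<alpha> by (auto simp: HC_class_def coset_carrier_update)
  qed
  ultimately show ?thesis by (auto simp: HC_restrict_def simp flip: HC_class_def)
qed

end

section \<open>The Mayer--Vietoris sequence\<close>

lemma eq_Collect_restrictI: "\<lbrakk>X \<subseteq> Y; \<And>y. y \<in> Y \<Longrightarrow> y \<in> X \<longleftrightarrow> P y\<rbrakk> \<Longrightarrow> X = {y \<in> Y. P y}"
  by blast

locale effect_algebra_union = effect_algebra E for E :: "('a, 'm) effect_algebra_scheme" +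
  fixes A B :: "'a set"
  assumes subA: "effect_subalgebra A E" and subB: "effect_subalgebra B E"
    and carrier_union: "carrier E = A \<union> B"
begin

abbreviation "EA \<equiv> E\<lparr>carrier := A\<rparr>"
abbreviation "EB \<equiv> E\<lparr>carrier := B\<rparr>"
abbreviation "EC \<equiv> E\<lparr>carrier := A \<inter> B\<rparr>"

lemma EC_sub: "effect_subalgebra (A \<inter> B) EA" "effect_subalgebra (A \<inter> B) EB"
    "effect_subalgebra (A \<inter> B) E"
proof -
  interpret A: effect_subalgebra A E by (rule subA)
  interpret B: effect_subalgebra B E by (rule subB)
  \<comment> \<open>The ambient algebras differ in their carriers only, so one argument for an
    arbitrary carrier \<open>S\<close> serves all three.\<close>
  have "effect_subalgebra (A \<inter> B) (E\<lparr>carrier := S\<rparr>)" if "A \<inter> B \<subseteq> S" for S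
  proof (rule effect_subalgebra.intro)
    show "c \<in> A \<inter> B" if "a \<in> A \<inter> B" "b \<in> A \<inter> B" "osum (E\<lparr>carrier := S\<rparr>) a b = Some c" for a b c
      using A.osum_mem[of a b c] B.osum_mem[of a b c] that by simp
  qed (use that A.ozero_mem B.ozero_mem A.oone_mem B.oone_mem A.ocompl_mem B.ocompl_mem in simp_all)
  from this[of A] this[of B] this[of "carrier E"] A.subset
  show "effect_subalgebra (A \<inter> B) EA" "effect_subalgebra (A \<inter> B) EB"
    "effect_subalgebra (A \<inter> B) E" by auto
qed

lemma EC_eq: "EA\<lparr>carrier := A \<inter> B\<rparr> = EC" "EB\<lparr>carrier := A \<inter> B\<rparr> = EC"
  by simp_all

sublocale EA: effect_algebra EA
  by (rule subalgebra_is_effect_algebra[OF subA])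

sublocale EB: effect_algebra EB
  by (rule subalgebra_is_effect_algebra[OF subB])

sublocale EC: effect_algebra EC
  by (rule subalgebra_is_effect_algebra[OF EC_sub(3)])

text \<open>Two entries of a test have a sum, and that sum lies in \<open>A\<close> or in \<open>B\<close>; so does, by
  cancellation, the other entry as soon as one of them does.\<close>

lemma tests_union: "tests E n = tests EA n \<union> tests EB n"
proof -
  have "set as \<subseteq> A \<or> set as \<subseteq> B" if as: "as \<in> tests E n" for as
  proof (rule ccontr)
    assume "\<not> ?thesis"
    then obtain x y where xy: "x \<in> set as" "x \<notin> B" "y \<in> set as" "y \<notin> A" by blast
    then have mem: "x \<in> A" "y \<in> B" "x \<in> carrier E" "y \<in> carrier E"
      using as carrier_union by (auto simp: tests_def)
    obtain us vs where us: "as = us @ x # vs" using xy(1) by (meson split_list)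
    \<comment> \<open>With \<open>x\<close> in front, the total is \<open>x \<boxplus> s\<close> for
      the sum \<open>s\<close> of the other entries. One of these is \<open>y\<close>, so
      \<open>s = y \<boxplus> r\<close>; then \<open>(r \<boxplus> y) \<boxplus> x\<close> is
      defined, and hence so is \<open>y \<boxplus> x\<close>.\<close>
    then have "rotate (length us) as = x # vs @ us" using rotate_append[of us "x # vs"] by simp
    then have "x # vs @ us \<in> tests E n" using tests_rotate[OF as] by metis
    then obtain s where s: "osum_list E (vs @ us) = Some s" "osum E x s = Some (oone E)"
      and sub: "set (vs @ us) \<subseteq> carrier E"
      by (auto simp: tests_def bind_eq_Some_conv)
    have "y \<in> set (vs @ us)" using xy us mem by auto
    then obtain r where r: "r \<in> carrier E" "osum E y r = Some s"
      using osum_list_member[OF sub s(1)] by blast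
    have "osum E s x = Some (oone E)" "osum E r y = Some s"
      using r mem s osum_list_closed[OF sub s(1)] osum_comm by blast+
    then obtain c where c: "osum E y x = Some c"
      using osum_assoc[of r y x s "oone E"] r mem by auto
    then have c': "osum E x y = Some c" "c \<in> A \<union> B"
      using mem osum_comm[of y x c] osum_closed[of y x c] carrier_union by auto
    show False using summand_mem[OF subA, of x y c] summand_mem[OF subB, of y x c] c c' mem xy
      by auto
  qed
  then show ?thesis using tests_subalgebra[OF subA] tests_subalgebra[OF subB] by blast
qed

lemma tests_inter: "tests EC n = tests EA n \<inter> tests EB n"
  using tests_subalgebra[OF subA] tests_subalgebra[OF subB] tests_subalgebra[OF EC_sub(3)] by blast

lemmas cochains_restrictA = cyclic_cochains_restrict[OF subA]
  and cochains_restrictB = cyclic_cochains_restrict[OF subB]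
  and coboundaryA = coboundary_subalgebra[OF subA]
  and coboundaryB = coboundary_subalgebra[OF subB]
  and coboundaryAC = EA.coboundary_subalgebra[OF EC_sub(1), unfolded EC_eq]
  and coboundaryBC = EB.coboundary_subalgebra[OF EC_sub(2), unfolded EC_eq]

section \<open>Extension by zero and gluing\<close>

definition extend_zero :: "int \<Rightarrow> ('a list \<Rightarrow> real) \<Rightarrow> 'a list \<Rightarrow> real" where
  "extend_zero n \<gamma> = (\<lambda>as\<in>tests EA n. if as \<in> tests EC n then \<gamma> as else 0)"

lemma extend_zero_EC: "as \<in> tests EC n \<Longrightarrow> extend_zero n \<gamma> as = \<gamma> as"
  by (simp add: extend_zero_def tests_inter)

lemma tests_rotate_last_iff:
  assumes S: "effect_subalgebra S E" and as: "as \<in> tests E n"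
  shows "last as # butlast as \<in> tests (E\<lparr>carrier := S\<rparr>) n \<longleftrightarrow> as \<in> tests (E\<lparr>carrier := S\<rparr>) n"
proof -
  have "as \<noteq> []" using as by (auto simp: tests_def)
  then have "set (last as # butlast as) = set as" by (cases as rule: rev_cases) auto
  then show ?thesis using as tests_rotate_last[OF as] tests_subalgebra[OF S] by simp
qed

text \<open>Whether a test lies in \<open>A \<inter> B\<close> depends on its set of entries, which
  rotation preserves. This provides the surjectivity in the short exact sequence of
  complexes.\<close>

lemma extend_zero_cyclic:
  assumes "\<gamma> \<in> cyclic_cochains EC n"
  shows "extend_zero n \<gamma> \<in> cyclic_cochains EA n"
proof -
  have "extend_zero n \<gamma> as = (-1) ^ nat n * extend_zero n \<gamma> (last as # butlast as)"
    if as: "as \<in> tests EA n" for as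
    using assms as tests_rotate_last_iff[OF EC_sub(3), of as n] EA.tests_rotate_last[OF as]
      tests_union by (auto simp: extend_zero_def cyclic_cochains_def)
  then show ?thesis by (auto simp: cyclic_cochains_def extend_zero_def)
qed

text \<open>The tests of \<open>A\<close> and of \<open>B\<close> cover those of \<open>E\<close>,
  overlap in the tests of \<open>A \<inter> B\<close>, and are each stable under rotation, so
  cyclicity can be checked on either side.\<close>

lemma glue_cyclic_cochains:
  assumes f: "f \<in> cyclic_cochains EA n" and h: "h \<in> cyclic_cochains EB n"
    and fh: "\<And>as. as \<in> tests EC n \<Longrightarrow> f as = h as"
  obtains \<omega> where "\<omega> \<in> cyclic_cochains E n"
    "\<And>as. as \<in> tests EA n \<Longrightarrow> \<omega> as = f as" "\<And>as. as \<in> tests EB n \<Longrightarrow> \<omega> as = h as"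
proof
  let ?\<omega> = "\<lambda>as\<in>tests E n. if as \<in> tests EA n then f as else h as"
  show \<omega>A: "?\<omega> as = f as" if "as \<in> tests EA n" for as using that tests_union by auto
  show \<omega>B: "?\<omega> as = h as" if "as \<in> tests EB n" for as
    using that tests_union tests_inter fh by auto
  have "?\<omega> as = (-1) ^ nat n * ?\<omega> (last as # butlast as)" if as: "as \<in> tests E n" for as
  proof -
    consider "as \<in> tests EA n" | "as \<in> tests EB n" using as tests_union by blast
    then show ?thesis
    proof cases
      case 1
      show ?thesis unfolding \<omega>A[OF 1] \<omega>A[OF EA.tests_rotate_last[OF 1]]
        using f 1 by (simp add: cyclic_cochains_def)
    next
      case 2
      show ?thesis unfolding \<omega>B[OF 2] \<omega>B[OF EB.tests_rotate_last[OF 2]]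
        using h 2 by (simp add: cyclic_cochains_def)
    qed
  qed
  then show "?\<omega> \<in> cyclic_cochains E n" by (auto simp: cyclic_cochains_def)
qed

section \<open>The connecting map on cocycles\<close>

text \<open>The snake construction for the lift \<open>(extend_zero n \<gamma>, 0)\<close> of
  \<open>\<gamma>\<close> along the difference of restrictions. On tests of
  \<open>A \<inter> B\<close> the formula for \<open>A\<close> takes precedence; the two formulas
  agree there if \<open>\<gamma>\<close> is a cocycle.\<close>

definition connecting :: "int \<Rightarrow> ('a list \<Rightarrow> real) \<Rightarrow> 'a list \<Rightarrow> real" where
  "connecting n \<gamma> = (\<lambda>as\<in>tests E (n + 1).
     if as \<in> tests EA (n + 1) then coboundary EA n (extend_zero n \<gamma>) as else 0)"

lemma connecting_EA:
  "as \<in> tests EA (n + 1) \<Longrightarrow> connecting n \<gamma> as = coboundary EA n (extend_zero n \<gamma>) as"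
  using tests_union by (auto simp: connecting_def)

text \<open>On a test of both subalgebras the coboundary of the extension is the coboundary of
  \<open>\<gamma>\<close> itself, which vanishes.\<close>

lemma connecting_EB:
  assumes "\<gamma> \<in> cyclic_cocycles EC n" "as \<in> tests EB (n + 1)"
  shows "connecting n \<gamma> as = 0"
proof (cases "as \<in> tests EA (n + 1)")
  case True
  then have as: "as \<in> tests EC (n + 1)" using assms tests_inter by blast
  have "coboundary EC n \<gamma> as = coboundary EA n (extend_zero n \<gamma>) as"
    using as by (rule coboundaryAC) (simp add: extend_zero_EC)
  then show ?thesis using EC.cyclic_cocyclesD(2)[OF assms(1) as] connecting_EA[OF True] by simp
qed (use assms tests_union in \<open>auto simp: connecting_def\<close>)

lemma connecting_cocycle:
  assumes \<gamma>: "\<gamma> \<in> cyclic_cocycles EC n"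
  shows "connecting n \<gamma> \<in> cyclic_cocycles E (n + 1)"
proof (rule cyclic_cocyclesI)
  have ext: "extend_zero n \<gamma> \<in> cyclic_cochains EA n"
    using \<gamma> by (intro extend_zero_cyclic EC.cyclic_cocyclesD(1))
  have "coboundary EA n (extend_zero n \<gamma>) as = (\<lambda>_\<in>tests EB (n + 1). 0) as"
    if "as \<in> tests EC (n + 1)" for as
    using that connecting_EA[of as n \<gamma>] connecting_EB[OF \<gamma>, of as] tests_inter by auto
  then obtain \<omega> where \<omega>: "\<omega> \<in> cyclic_cochains E (n + 1)"
    "\<And>as. as \<in> tests EA (n + 1) \<Longrightarrow> \<omega> as = coboundary EA n (extend_zero n \<gamma>) as"
    "\<And>as. as \<in> tests EB (n + 1) \<Longrightarrow> \<omega> as = (\<lambda>_\<in>tests EB (n + 1). 0) as"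
    using glue_cyclic_cochains[OF EA.coboundary_cyclic[OF ext] EB.zero_cyclic_cochains] by blast
  \<comment> \<open>Identifying the map with a glued cochain gives its cyclicity without a separate
    computation.\<close>
  have "connecting n \<gamma> = \<omega>"
  proof (rule extensionalityI)
    show "connecting n \<gamma> \<in> extensional (tests E (n + 1))" by (simp add: connecting_def)
    show "\<omega> \<in> extensional (tests E (n + 1))" using \<omega>(1) by (auto simp: cyclic_cochains_def PiE_iff)
    fix as assume "as \<in> tests E (n + 1)"
    then show "connecting n \<gamma> as = \<omega> as"
      using \<omega>(2,3)[of as] connecting_EA[of as n \<gamma>] connecting_EB[OF \<gamma>, of as] tests_union by auto
  qed
  then show "connecting n \<gamma> \<in> cyclic_cochains E (n + 1)" using \<omega>(1) by simp
  fix as assume "as \<in> tests E (n + 1 + 1)"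
  then consider "as \<in> tests EA (n + 1 + 1)" | "as \<in> tests EB (n + 1 + 1)" using tests_union by blast
  then show "coboundary E (n + 1) (connecting n \<gamma>) as = 0"
  proof cases
    case 1
    have "coboundary EA (n + 1) (coboundary EA n (extend_zero n \<gamma>)) as
        = coboundary E (n + 1) (connecting n \<gamma>) as"
      using 1 by (rule coboundaryA) (simp add: connecting_EA)
    moreover have "coboundary EA (n + 1) (coboundary EA n (extend_zero n \<gamma>)) as = 0"
      using EA.coboundary_coboundary[OF ext] 1 by (simp add: add.assoc)
    ultimately show ?thesis by simp
  next
    case 2
    \<comment> \<open>On \<open>B\<close> the cochain agrees with zero, written here as a linear
      combination so that linearity of the coboundary applies.\<close>
    have "coboundary EB (n + 1) (lin_comb2 (tests EB (n + 1)) 0 \<gamma> 0 \<gamma>) as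
        = coboundary E (n + 1) (connecting n \<gamma>) as"
      using 2 by (rule coboundaryB) (simp add: connecting_EB[OF \<gamma>] lin_comb2_apply)
    then show ?thesis using 2 by (simp add: EB.coboundary_lin_comb2 lin_comb2_apply)
  qed
qed

lemma connecting_lin_comb2:
  "connecting n (lin_comb2 (tests EC n) a \<gamma> b \<gamma>')
    = lin_comb2 (tests E (n + 1)) a (connecting n \<gamma>) b (connecting n \<gamma>')"
proof -
  have e: "extend_zero n (lin_comb2 (tests EC n) a \<gamma> b \<gamma>')
      = lin_comb2 (tests EA n) a (extend_zero n \<gamma>) b (extend_zero n \<gamma>')"
    by (auto simp: extend_zero_def lin_comb2_def restrict_def)
  show ?thesis
    unfolding connecting_def e EA.coboundary_lin_comb2 by (auto simp: lin_comb2_def restrict_def)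
qed

text \<open>For \<open>\<alpha> = \<beta> = 0\<close>: the class of the connecting cocycle depends on the class of \<open>\<gamma>\<close> only.\<close>

lemma connecting_coboundaryI:
  assumes \<gamma>: "\<gamma> \<in> cyclic_cocycles EC n"
    and \<alpha>: "\<alpha> \<in> cyclic_cocycles EA n" and \<beta>: "\<beta> \<in> cyclic_cocycles EB n"
    and \<eta>: "\<eta> \<in> cyclic_cochains EC (n - 1)"
    and eq: "\<And>as. as \<in> tests EC n \<Longrightarrow> \<gamma> as - (\<alpha> as - \<beta> as) = coboundary EC (n - 1) \<eta> as"
  shows "connecting n \<gamma> \<in> cyclic_coboundaries E (n + 1)"
proof -
  let ?\<eta> = "coboundary EA (n - 1) (extend_zero (n - 1) \<eta>)"
  \<comment> \<open>On \<open>A \<inter> B\<close> the hypothesis says that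
    \<open>\<gamma> - \<alpha>\<close> minus the coboundary of \<open>\<eta>\<close> is
    \<open>-\<beta>\<close>, so \<open>?f\<close> and \<open>?h\<close> can be glued. Subtracting
    cocycles from the extension does not change its coboundary, and that of \<open>?h\<close> is
    zero.\<close>
  let ?f = "lin_comb2 (tests EA n) 1 (lin_comb2 (tests EA n) 1 (extend_zero n \<gamma>) (-1) \<alpha>) (-1) ?\<eta>"
  let ?h = "lin_comb2 (tests EB n) (-1) \<beta> 0 \<beta>"
  note [simp] = EA.cyclic_cocyclesD[OF \<alpha>] EB.cyclic_cocyclesD[OF \<beta>] EC.cyclic_cocyclesD[OF \<gamma>]
  have \<eta>A: "extend_zero (n - 1) \<eta> \<in> cyclic_cochains EA (n - 1)" using \<eta> by (rule extend_zero_cyclic)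
  have "?f \<in> cyclic_cochains EA n"
    using \<eta> by (intro EA.cyclic_cochains_lin_comb2 extend_zero_cyclic EA.coboundary_cyclic_pred) simp_all
  moreover have "?h \<in> cyclic_cochains EB n" by (intro EB.cyclic_cochains_lin_comb2) simp_all
  moreover have "?f as = ?h as" if as: "as \<in> tests EC n" for as
  proof -
    have "coboundary EC (n - 1) \<eta> as = ?\<eta> as"
      using coboundaryAC[of as "n - 1" \<eta> "extend_zero (n - 1) \<eta>"] as by (simp add: extend_zero_EC)
    then show ?thesis using eq[OF as] as tests_inter by (auto simp: lin_comb2_apply extend_zero_EC)
  qed
  ultimately obtain \<omega> where \<omega>: "\<omega> \<in> cyclic_cochains E n"
    "\<And>as. as \<in> tests EA n \<Longrightarrow> \<omega> as = ?f as" "\<And>as. as \<in> tests EB n \<Longrightarrow> \<omega> as = ?h as"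
    using glue_cyclic_cochains by blast
  show ?thesis
  proof (rule cyclic_coboundariesI)
    show "\<omega> \<in> cyclic_cochains E (n + 1 - 1)" using \<omega>(1) by simp
    show "connecting n \<gamma> \<in> extensional (tests E (n + 1))" by (simp add: connecting_def)
    fix as assume "as \<in> tests E (n + 1)"
    then consider "as \<in> tests EA (n + 1)" | "as \<in> tests EB (n + 1)" using tests_union by blast
    then have "connecting n \<gamma> as = coboundary E n \<omega> as"
    proof cases
      case 1
      have "coboundary EA n ?f as = coboundary E n \<omega> as"
        using 1 by (rule coboundaryA) (simp add: \<omega>(2))
      moreover have "coboundary EA n ?\<eta> as = 0"
        using \<eta>A 1 by (rule EA.coboundary_coboundary_apply)
      ultimately show ?thesis using 1
        by (simp add: connecting_EA EA.coboundary_lin_comb2 lin_comb2_apply)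
    next
      case 2
      have "coboundary EB n ?h as = coboundary E n \<omega> as"
        using 2 by (rule coboundaryB) (simp add: \<omega>(3))
      then show ?thesis using 2
        by (simp add: connecting_EB[OF \<gamma>] EB.coboundary_lin_comb2 lin_comb2_apply)
    qed
    then show "connecting n \<gamma> as = coboundary E (n + 1 - 1) \<omega> as" by simp
  qed
qed

section \<open>Exactness on the level of cocycles\<close>

text \<open>If \<open>\<omega>\<close> is a primitive on \<open>E\<close>, then the extension of
  \<open>\<gamma>\<close> minus \<open>\<omega>\<close> is closed on \<open>A\<close>, and
  \<open>-\<omega>\<close> is closed on \<open>B\<close>. On \<open>A \<inter> B\<close> their
  difference is \<open>\<gamma>\<close>.\<close>

lemma connecting_coboundaryE:
  assumes \<gamma>: "\<gamma> \<in> cyclic_cocycles EC n" and "connecting n \<gamma> \<in> cyclic_coboundaries E (n + 1)"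
  obtains \<alpha> \<beta> where "\<alpha> \<in> cyclic_cocycles EA n" "\<beta> \<in> cyclic_cocycles EB n"
    "\<And>as. as \<in> tests EC n \<Longrightarrow> \<gamma> as = \<alpha> as - \<beta> as"
proof -
  obtain \<omega> where \<omega>: "\<omega> \<in> cyclic_cochains E n" "connecting n \<gamma> = coboundary E n \<omega>"
    using assms(2) by (auto simp: cyclic_coboundaries_def)
  let ?\<omega>A = "restrict \<omega> (tests EA n)" and ?\<omega>B = "restrict \<omega> (tests EB n)"
  let ?\<alpha> = "lin_comb2 (tests EA n) 1 (extend_zero n \<gamma>) (-1) ?\<omega>A"
  let ?\<beta> = "lin_comb2 (tests EB n) (-1) ?\<omega>B 0 ?\<omega>B"
  show thesis
  proof
    show "?\<alpha> \<in> cyclic_cocycles EA n"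
    proof (rule EA.cyclic_cocyclesI)
      show "?\<alpha> \<in> cyclic_cochains EA n"
        using \<gamma> \<omega>(1) by (intro EA.cyclic_cochains_lin_comb2 extend_zero_cyclic cochains_restrictA
            EC.cyclic_cocyclesD(1))
      fix as assume as: "as \<in> tests EA (n + 1)"
      have "coboundary EA n ?\<omega>A as = coboundary E n \<omega> as" using as by (rule coboundaryA) simp
      then show "coboundary EA n ?\<alpha> as = 0"
        using as by (simp add: EA.coboundary_lin_comb2 lin_comb2_apply connecting_EA flip: \<omega>(2))
    qed
    show "?\<beta> \<in> cyclic_cocycles EB n"
    proof (rule EB.cyclic_cocyclesI)
      show "?\<beta> \<in> cyclic_cochains EB n"
        using \<omega>(1) by (intro EB.cyclic_cochains_lin_comb2 cochains_restrictB)
      fix as assume as: "as \<in> tests EB (n + 1)"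
      have "coboundary EB n ?\<omega>B as = coboundary E n \<omega> as" using as by (rule coboundaryB) simp
      then show "coboundary EB n ?\<beta> as = 0"
        using as by (simp add: EB.coboundary_lin_comb2 lin_comb2_apply connecting_EB[OF \<gamma>] flip: \<omega>(2))
    qed
    show "\<gamma> as = ?\<alpha> as - ?\<beta> as" if "as \<in> tests EC n" for as
      using that tests_inter by (auto simp: lin_comb2_apply extend_zero_EC)
  qed
qed

text \<open>Primitives of \<open>\<epsilon>\<close> on \<open>A\<close> and on \<open>B\<close>
  differ on \<open>A \<inter> B\<close> by a cocycle \<open>\<gamma>\<close>, whose connecting
  cocycle is cohomologous to \<open>\<epsilon>\<close>. Conversely, a connecting cocycle is the
  coboundary of the extension on \<open>A\<close> and zero on \<open>B\<close>.\<close>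

lemma restrict_coboundary_iff:
  assumes \<epsilon>: "\<epsilon> \<in> cyclic_cocycles E n"
  shows "restrict \<epsilon> (tests EA n) \<in> cyclic_coboundaries EA n
      \<and> restrict \<epsilon> (tests EB n) \<in> cyclic_coboundaries EB n
    \<longleftrightarrow> (\<exists>\<gamma>\<in>cyclic_cocycles EC (n - 1).
          lin_comb2 (tests E n) 1 (connecting (n - 1) \<gamma>) (-1) \<epsilon> \<in> cyclic_coboundaries E n)"
    (is "?L \<longleftrightarrow> ?R")
proof
  assume ?L
  then obtain a b where a: "a \<in> cyclic_cochains EA (n - 1)"
      "restrict \<epsilon> (tests EA n) = coboundary EA (n - 1) a"
    and b: "b \<in> cyclic_cochains EB (n - 1)" "restrict \<epsilon> (tests EB n) = coboundary EB (n - 1) b"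
    by (auto simp: cyclic_coboundaries_def)
  define aC bC where "aC = restrict a (tests EC (n - 1))" and "bC = restrict b (tests EC (n - 1))"
  define \<gamma> where "\<gamma> = lin_comb2 (tests EC (n - 1)) 1 aC (-1) bC"
  have \<epsilon>a: "\<epsilon> as = coboundary EA (n - 1) a as" if "as \<in> tests EA n" for as
    using that by (simp flip: a(2))
  have \<epsilon>b: "\<epsilon> as = coboundary EB (n - 1) b as" if "as \<in> tests EB n" for as
    using that by (simp flip: b(2))
  have \<gamma>: "\<gamma> \<in> cyclic_cocycles EC (n - 1)"
  proof (rule EC.cyclic_cocyclesI)
    show "\<gamma> \<in> cyclic_cochains EC (n - 1)"
      using a b EA.cyclic_cochains_restrict[OF EC_sub(1)] EB.cyclic_cochains_restrict[OF EC_sub(2)]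
      unfolding \<gamma>_def aC_def bC_def by (intro EC.cyclic_cochains_lin_comb2) auto
    fix as assume as: "as \<in> tests EC (n - 1 + 1)"
    have "coboundary EC (n - 1) aC as = coboundary EA (n - 1) a as"
      using as by (rule coboundaryAC) (simp add: aC_def)
    moreover have "coboundary EC (n - 1) bC as = coboundary EB (n - 1) b as"
      using as by (rule coboundaryBC) (simp add: bC_def)
    moreover have "coboundary EA (n - 1) a as = coboundary EB (n - 1) b as"
      using as \<epsilon>a[of as] \<epsilon>b[of as] tests_inter by simp
    ultimately show "coboundary EC (n - 1) \<gamma> as = 0"
      using as by (simp add: \<gamma>_def EC.coboundary_lin_comb2 lin_comb2_apply)
  qed
  \<comment> \<open>On \<open>A \<inter> B\<close>, \<open>\<gamma> - a\<close> equals
    \<open>-b\<close>. The glued cochain is the primitive of the connecting cocycle minus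
    \<open>\<epsilon>\<close>.\<close>
  let ?f = "lin_comb2 (tests EA (n - 1)) 1 (extend_zero (n - 1) \<gamma>) (-1) a"
  let ?h = "lin_comb2 (tests EB (n - 1)) (-1) b 0 b"
  have "?f \<in> cyclic_cochains EA (n - 1)"
    using a \<gamma> by (intro EA.cyclic_cochains_lin_comb2 extend_zero_cyclic EC.cyclic_cocyclesD(1))
  moreover have "?h \<in> cyclic_cochains EB (n - 1)" using b by (intro EB.cyclic_cochains_lin_comb2)
  moreover have "?f as = ?h as" if "as \<in> tests EC (n - 1)" for as
    using that tests_inter by (auto simp: lin_comb2_apply extend_zero_EC \<gamma>_def aC_def bC_def)
  ultimately obtain \<omega> where \<omega>: "\<omega> \<in> cyclic_cochains E (n - 1)"
    "\<And>as. as \<in> tests EA (n - 1) \<Longrightarrow> \<omega> as = ?f as" "\<And>as. as \<in> tests EB (n - 1) \<Longrightarrow> \<omega> as = ?h as"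
    using glue_cyclic_cochains by blast
  have "lin_comb2 (tests E n) 1 (connecting (n - 1) \<gamma>) (-1) \<epsilon> \<in> cyclic_coboundaries E n"
  proof (rule cyclic_coboundariesI[OF \<omega>(1)])
    fix as assume as: "as \<in> tests E n"
    then consider "as \<in> tests EA (n - 1 + 1)" | "as \<in> tests EB (n - 1 + 1)"
      using tests_union by auto
    then show "lin_comb2 (tests E n) 1 (connecting (n - 1) \<gamma>) (-1) \<epsilon> as = coboundary E (n - 1) \<omega> as"
    proof cases
      case 1
      have "coboundary EA (n - 1) ?f as = coboundary E (n - 1) \<omega> as"
        using 1 by (rule coboundaryA) (simp add: \<omega>(2))
      then show ?thesis using 1 as connecting_EA[OF 1, of \<gamma>]
        by (simp add: EA.coboundary_lin_comb2 lin_comb2_apply \<epsilon>a)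
    next
      case 2
      have "coboundary EB (n - 1) ?h as = coboundary E (n - 1) \<omega> as"
        using 2 by (rule coboundaryB) (simp add: \<omega>(3))
      then show ?thesis using 2 as connecting_EB[OF \<gamma> 2]
        by (simp add: EB.coboundary_lin_comb2 lin_comb2_apply \<epsilon>b)
    qed
  qed (simp add: lin_comb2_def)
  then show ?R using \<gamma> by blast
next
  assume ?R
  then obtain \<gamma> \<omega> where \<gamma>: "\<gamma> \<in> cyclic_cocycles EC (n - 1)" and \<omega>: "\<omega> \<in> cyclic_cochains E (n - 1)"
    and eq: "lin_comb2 (tests E n) 1 (connecting (n - 1) \<gamma>) (-1) \<epsilon> = coboundary E (n - 1) \<omega>"
    by (auto simp: cyclic_coboundaries_def)
  have \<epsilon>_eq: "\<epsilon> as = connecting (n - 1) \<gamma> as - coboundary E (n - 1) \<omega> as" if "as \<in> tests E n" for as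
    using that by (simp add: lin_comb2_apply flip: eq)
  let ?\<omega>A = "restrict \<omega> (tests EA (n - 1))" and ?\<omega>B = "restrict \<omega> (tests EB (n - 1))"
  have "restrict \<epsilon> (tests EA n) \<in> cyclic_coboundaries EA n"
  proof (rule EA.cyclic_coboundariesI)
    let ?f = "lin_comb2 (tests EA (n - 1)) 1 (extend_zero (n - 1) \<gamma>) (-1) ?\<omega>A"
    show "?f \<in> cyclic_cochains EA (n - 1)"
      using \<gamma> \<omega> by (intro EA.cyclic_cochains_lin_comb2 extend_zero_cyclic cochains_restrictA
          EC.cyclic_cocyclesD(1))
    fix as assume "as \<in> tests EA n"
    then have as: "as \<in> tests EA (n - 1 + 1)" by simp
    have "coboundary EA (n - 1) ?\<omega>A as = coboundary E (n - 1) \<omega> as" using as by (rule coboundaryA) simp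
    then show "restrict \<epsilon> (tests EA n) as = coboundary EA (n - 1) ?f as"
      using as connecting_EA[OF as, of \<gamma>] \<epsilon>_eq[of as] tests_union[of n]
      by (simp add: EA.coboundary_lin_comb2 lin_comb2_apply)
  qed simp
  moreover have "restrict \<epsilon> (tests EB n) \<in> cyclic_coboundaries EB n"
  proof (rule EB.cyclic_coboundariesI)
    let ?h = "lin_comb2 (tests EB (n - 1)) (-1) ?\<omega>B 0 ?\<omega>B"
    show "?h \<in> cyclic_cochains EB (n - 1)"
      using \<omega> by (intro EB.cyclic_cochains_lin_comb2 cochains_restrictB)
    fix as assume "as \<in> tests EB n"
    then have as: "as \<in> tests EB (n - 1 + 1)" by simp
    have "coboundary EB (n - 1) ?\<omega>B as = coboundary E (n - 1) \<omega> as" using as by (rule coboundaryB) simp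
    then show "restrict \<epsilon> (tests EB n) as = coboundary EB (n - 1) ?h as"
      using as connecting_EB[OF \<gamma> as] \<epsilon>_eq[of as] tests_union[of n]
      by (simp add: EB.coboundary_lin_comb2 lin_comb2_apply)
  qed simp
  ultimately show ?L by blast
qed

text \<open>Subtracting from \<open>\<alpha>\<close> the coboundary of the extended primitive
  \<open>\<eta>\<close> makes it agree with \<open>\<beta>\<close> on \<open>A \<inter> B\<close>.
  The two then glue, and only the class on \<open>A\<close> has to absorb a correction.\<close>

lemma restrict_diff_coboundaryE:
  assumes \<alpha>: "\<alpha> \<in> cyclic_cocycles EA n" and \<beta>: "\<beta> \<in> cyclic_cocycles EB n"
    and "lin_comb2 (tests EC n) 1 (restrict \<alpha> (tests EC n)) (-1) (restrict \<beta> (tests EC n))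
      \<in> cyclic_coboundaries EC n"
  obtains \<epsilon> where "\<epsilon> \<in> cyclic_cocycles E n"
    "lin_comb2 (tests EA n) 1 (restrict \<epsilon> (tests EA n)) (-1) \<alpha> \<in> cyclic_coboundaries EA n"
    "restrict \<epsilon> (tests EB n) = \<beta>"
proof -
  obtain \<eta> where \<eta>: "\<eta> \<in> cyclic_cochains EC (n - 1)"
    and eq: "lin_comb2 (tests EC n) 1 (restrict \<alpha> (tests EC n)) (-1) (restrict \<beta> (tests EC n))
      = coboundary EC (n - 1) \<eta>"
    using assms(3) by (auto simp: cyclic_coboundaries_def)
  note [simp] = EA.cyclic_cocyclesD[OF \<alpha>] EB.cyclic_cocyclesD[OF \<beta>]
  let ?e = "extend_zero (n - 1) \<eta>"
  let ?\<eta> = "coboundary EA (n - 1) ?e"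
  let ?f = "lin_comb2 (tests EA n) 1 \<alpha> (-1) ?\<eta>"
  have e: "?e \<in> cyclic_cochains EA (n - 1)" using \<eta> by (rule extend_zero_cyclic)
  have "?f \<in> cyclic_cochains EA n"
    using e by (intro EA.cyclic_cochains_lin_comb2 EA.coboundary_cyclic_pred) simp_all
  moreover have "\<beta> \<in> cyclic_cochains EB n" by simp
  moreover have "?f as = \<beta> as" if as: "as \<in> tests EC n" for as
  proof -
    have "coboundary EC (n - 1) \<eta> as = ?\<eta> as"
      using coboundaryAC[of as "n - 1" \<eta> ?e] as by (simp add: extend_zero_EC)
    moreover have "\<alpha> as - \<beta> as = coboundary EC (n - 1) \<eta> as"
      using as by (simp add: lin_comb2_apply flip: eq)
    ultimately show ?thesis using as tests_inter by (simp add: lin_comb2_apply)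
  qed
  ultimately obtain \<epsilon> where \<epsilon>: "\<epsilon> \<in> cyclic_cochains E n"
    "\<And>as. as \<in> tests EA n \<Longrightarrow> \<epsilon> as = ?f as" "\<And>as. as \<in> tests EB n \<Longrightarrow> \<epsilon> as = \<beta> as"
    using glue_cyclic_cochains by blast
  show thesis
  proof
    show "\<epsilon> \<in> cyclic_cocycles E n"
    proof (rule cyclic_cocyclesI[OF \<epsilon>(1)])
      fix as assume "as \<in> tests E (n + 1)"
      then consider "as \<in> tests EA (n + 1)" | "as \<in> tests EB (n + 1)" using tests_union by blast
      then show "coboundary E n \<epsilon> as = 0"
      proof cases
        case 1
        have "coboundary EA n ?f as = coboundary E n \<epsilon> as"
          using 1 by (rule coboundaryA) (simp add: \<epsilon>(2))
        moreover have "coboundary EA n ?\<eta> as = 0" using e 1 by (rule EA.coboundary_coboundary_apply)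
        ultimately show ?thesis using 1 by (simp add: EA.coboundary_lin_comb2 lin_comb2_apply)
      next
        case 2
        have "coboundary EB n \<beta> as = coboundary E n \<epsilon> as"
          using 2 by (rule coboundaryB) (simp add: \<epsilon>(3))
        then show ?thesis using 2 by simp
      qed
    qed
    show "restrict \<epsilon> (tests EB n) = \<beta>"
      using EB.cyclic_cocycles_ext[OF \<beta>] \<epsilon>(3)
      by (intro extensionalityI[of _ "tests EB n"]) auto
    show "lin_comb2 (tests EA n) 1 (restrict \<epsilon> (tests EA n)) (-1) \<alpha> \<in> cyclic_coboundaries EA n"
    proof (rule EA.cyclic_coboundariesI)
      show "lin_comb2 (tests EA (n - 1)) (-1) ?e 0 ?e \<in> cyclic_cochains EA (n - 1)"
        using e by (intro EA.cyclic_cochains_lin_comb2)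
      fix as assume as: "as \<in> tests EA n"
      then show "lin_comb2 (tests EA n) 1 (restrict \<epsilon> (tests EA n)) (-1) \<alpha> as
        = coboundary EA (n - 1) (lin_comb2 (tests EA (n - 1)) (-1) ?e 0 ?e) as"
        by (simp add: EA.coboundary_lin_comb2 lin_comb2_apply \<epsilon>(2))
    qed (simp add: lin_comb2_def)
  qed
qed

section \<open>The connecting map on cohomology\<close>

text \<open>A representative is chosen; \<open>connecting_HC_class\<close> removes the dependence on
  this choice.\<close>

definition connecting_HC :: "int \<Rightarrow> ('a list \<Rightarrow> real) set \<Rightarrow> ('a list \<Rightarrow> real) set" where
  "connecting_HC n \<xi> = HC_class E (n + 1)
     (connecting n (SOME \<gamma>. \<gamma> \<in> cyclic_cocycles EC n \<and> HC_class EC n \<gamma> = \<xi>))"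

text \<open>The chosen representative differs from \<open>\<gamma>\<close> by a coboundary, and
  \<open>connecting_coboundaryI\<close> with zero cocycles on \<open>A\<close> and \<open>B\<close>
  sends this difference to a coboundary.\<close>

lemma connecting_HC_class:
  assumes \<gamma>: "\<gamma> \<in> cyclic_cocycles EC n"
  shows "connecting_HC n (HC_class EC n \<gamma>) = HC_class E (n + 1) (connecting n \<gamma>)"
proof -
  let ?P = "\<lambda>\<gamma>'. \<gamma>' \<in> cyclic_cocycles EC n \<and> HC_class EC n \<gamma>' = HC_class EC n \<gamma>"
  define \<gamma>' where "\<gamma>' = (SOME \<gamma>'. ?P \<gamma>')"
  have "?P \<gamma>'" unfolding \<gamma>'_def using \<gamma> by (intro someI_ex[of ?P]) blast
  then have \<gamma>': "\<gamma>' \<in> cyclic_cocycles EC n" and "HC_class EC n \<gamma>' = HC_class EC n \<gamma>" by simp_all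
  let ?d = "lin_comb2 (tests EC n) 1 \<gamma>' (-1) \<gamma>"
  have d: "?d \<in> cyclic_cocycles EC n" using \<gamma>' \<gamma> by (rule EC.cyclic_cocycles_lin_comb2)
  have "?d \<in> cyclic_coboundaries EC n"
    using \<open>HC_class EC n \<gamma>' = _\<close> EC.HC_class_eq_iff[OF \<gamma>' \<gamma>] by simp
  then obtain \<eta> where \<eta>: "\<eta> \<in> cyclic_cochains EC (n - 1)" "?d = coboundary EC (n - 1) \<eta>"
    by (auto simp: cyclic_coboundaries_def)
  have "lin_comb2 (tests EA n) 0 \<gamma> 0 \<gamma> \<in> cyclic_cocycles EA n"
    "lin_comb2 (tests EB n) 0 \<gamma> 0 \<gamma> \<in> cyclic_cocycles EB n"
    using EA.zero_cyclic_coboundaries EA.cyclic_coboundaries_subset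
      EB.zero_cyclic_coboundaries EB.cyclic_coboundaries_subset by blast+
  with d have "connecting n ?d \<in> cyclic_coboundaries E (n + 1)"
  proof (rule connecting_coboundaryI[OF _ _ _ \<eta>(1)])
    fix as assume "as \<in> tests EC n"
    moreover from this have "as \<in> tests EA n" "as \<in> tests EB n" using tests_inter by blast+
    ultimately show "?d as - (lin_comb2 (tests EA n) 0 \<gamma> 0 \<gamma> as - lin_comb2 (tests EB n) 0 \<gamma> 0 \<gamma> as)
        = coboundary EC (n - 1) \<eta> as"
      by (simp add: lin_comb2_apply flip: \<eta>(2))
  qed
  then have "HC_class E (n + 1) (connecting n \<gamma>') = HC_class E (n + 1) (connecting n \<gamma>)"
    using HC_class_eq_iff[OF connecting_cocycle[OF \<gamma>'] connecting_cocycle[OF \<gamma>]]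
    by (simp add: connecting_lin_comb2)
  then show ?thesis by (simp add: connecting_HC_def \<gamma>'_def)
qed

section \<open>The maps of the sequence and their linearity\<close>

abbreviation "S n \<equiv> direct_sum (HC EA n) (HC EB n)"
abbreviation "\<rho> \<equiv> HC_restrict_pair EA EB"
abbreviation "\<sigma> \<equiv> HC_restrict_diff EC"

lemma restrict_pair_class:
  "\<epsilon> \<in> cyclic_cocycles E n \<Longrightarrow> \<rho> n (HC_class E n \<epsilon>)
    = (HC_class EA n (restrict \<epsilon> (tests EA n)), HC_class EB n (restrict \<epsilon> (tests EB n)))"
  by (simp add: HC_restrict_pair_def HC_restrict_class[OF subA] HC_restrict_class[OF subB])

lemmas restrict_cocycles =
  cyclic_cocycles_restrict[OF subA] cyclic_cocycles_restrict[OF subB]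
  EA.cyclic_cocycles_restrict[OF EC_sub(1), unfolded EC_eq]
  EB.cyclic_cocycles_restrict[OF EC_sub(2), unfolded EC_eq]

lemma restrict_diff_class:
  assumes "\<alpha> \<in> cyclic_cocycles EA n" "\<beta> \<in> cyclic_cocycles EB n"
  shows "\<sigma> n (HC_class EA n \<alpha>, HC_class EB n \<beta>) = HC_class EC n
    (lin_comb2 (tests EC n) 1 (restrict \<alpha> (tests EC n)) (-1) (restrict \<beta> (tests EC n)))"
  using assms EA.HC_restrict_class[OF EC_sub(1), of \<alpha> n] EB.HC_restrict_class[OF EC_sub(2), of \<beta> n]
    EC.HC_class_diff restrict_cocycles(3,4)
  by (simp add: HC_restrict_diff_def)

lemma linear_connecting: "linear_map class_ring (HC EC n) (HC E (n + 1)) (connecting_HC n)"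
  by (rule EC.linear_map_HCI)
    (simp_all add: vectorspace_HC connecting_HC_class carrier_HC connecting_cocycle
      EC.cyclic_cocycles_lin_comb2 connecting_lin_comb2 HC_class_add HC_class_smult)

lemma vectorspace_sum: "vectorspace class_ring (S n)"
  using EA.vectorspace_HC EB.vectorspace_HC by (rule direct_sum_is_vs)

lemma linear_restrict_pair: "linear_map class_ring (HC E n) (S n) (\<rho> n)"
  by (rule linear_map_HCI[OF vectorspace_sum])
    (simp_all add: restrict_pair_class cyclic_cocycles_lin_comb2 direct_sum_def
      restrict_lin_comb2[OF subA] restrict_lin_comb2[OF subB] EA.carrier_HC EB.carrier_HC
      restrict_cocycles EA.HC_class_add EB.HC_class_add EA.HC_class_smult EB.HC_class_smult)

lemma linear_restrict_diff: "linear_map class_ring (S n) (HC EC n) (\<sigma> n)"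
proof -
  let ?d = "\<lambda>\<alpha> \<beta>. lin_comb2 (tests EC n) 1 (restrict \<alpha> (tests EC n)) (-1) (restrict \<beta> (tests EC n))"
  have d: "?d \<alpha> \<beta> \<in> cyclic_cocycles EC n"
    if "\<alpha> \<in> cyclic_cocycles EA n" "\<beta> \<in> cyclic_cocycles EB n" for \<alpha> \<beta>
    using that restrict_cocycles(3,4) EC.cyclic_cocycles_lin_comb2 by blast
  have lin: "?d (lin_comb2 (tests EA n) a \<alpha> b \<alpha>') (lin_comb2 (tests EB n) a \<beta> b \<beta>')
      = lin_comb2 (tests EC n) a (?d \<alpha> \<beta>) b (?d \<alpha>' \<beta>')" for a b \<alpha> \<alpha>' \<beta> \<beta>'
    using tests_inter by (auto simp: lin_comb2_def restrict_def algebra_simps)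
  \<comment> \<open>The domain is a direct sum, so \<open>linear_map_HCI\<close> does not apply; the
    conditions are checked on pairs of classes.\<close>
  have "\<sigma> n \<in> LinearCombinations.module_hom class_ring (S n) (HC EC n)"
    by (auto simp: LinearCombinations.module_hom_def direct_sum_def EA.carrier_HC EB.carrier_HC
        EC.carrier_HC EA.HC_class_add EB.HC_class_add EA.HC_class_smult EB.HC_class_smult
        EC.HC_class_add EC.HC_class_smult restrict_diff_class d lin
        EA.cyclic_cocycles_lin_comb2 EB.cyclic_cocycles_lin_comb2)
  then show ?thesis using vectorspace_sum EC.vectorspace_HC
    by (simp add: linear_map_def mod_hom_def mod_hom_axioms_def vectorspace_def)
qed

section \<open>Exactness in cohomology\<close>

text \<open>On cocycles this is \<open>restrict_coboundary_iff\<close>;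
  \<open>HC_class_eq_iff\<close> turns the coboundary condition into an equality of classes.\<close>

lemma exact_ambient:
  "exact_at class_ring (HC EC (n - 1)) (connecting_HC (n - 1)) (HC E n) (\<rho> n) (S n)"
proof -
  have lin: "linear_map class_ring (HC EC (n - 1)) (HC E n) (connecting_HC (n - 1))"
    using linear_connecting[of "n - 1"] by simp
  have conn: "connecting (n - 1) \<gamma> \<in> cyclic_cocycles E n"
    "connecting_HC (n - 1) (HC_class EC (n - 1) \<gamma>) = HC_class E n (connecting (n - 1) \<gamma>)"
    if "\<gamma> \<in> cyclic_cocycles EC (n - 1)" for \<gamma>
    using connecting_cocycle[OF that] connecting_HC_class[OF that] by simp_all
  have "\<rho> n (HC_class E n \<epsilon>) = \<zero>\<^bsub>S n\<^esub>
      \<longleftrightarrow> HC_class E n \<epsilon> \<in> connecting_HC (n - 1) ` carrier (HC EC (n - 1))"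
    if \<epsilon>: "\<epsilon> \<in> cyclic_cocycles E n" for \<epsilon>
  proof -
    have "\<rho> n (HC_class E n \<epsilon>) = \<zero>\<^bsub>S n\<^esub>
      \<longleftrightarrow> restrict \<epsilon> (tests EA n) \<in> cyclic_coboundaries EA n
        \<and> restrict \<epsilon> (tests EB n) \<in> cyclic_coboundaries EB n"
      using \<epsilon> by (simp add: restrict_pair_class direct_sum_def EA.HC_class_zero_iff
          EB.HC_class_zero_iff restrict_cocycles)
    also have "\<dots> \<longleftrightarrow> (\<exists>\<gamma>\<in>cyclic_cocycles EC (n - 1).
        HC_class E n (connecting (n - 1) \<gamma>) = HC_class E n \<epsilon>)"
      unfolding restrict_coboundary_iff[OF \<epsilon>] using HC_class_eq_iff[OF conn(1) \<epsilon>] by blast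
    also have "\<dots> \<longleftrightarrow> HC_class E n \<epsilon> \<in> connecting_HC (n - 1) ` carrier (HC EC (n - 1))"
      using conn(2) by (force simp: EC.carrier_HC)
    finally show ?thesis .
  qed
  then have "\<xi> \<in> connecting_HC (n - 1) ` carrier (HC EC (n - 1))
      \<longleftrightarrow> \<rho> n \<xi> = \<zero>\<^bsub>S n\<^esub>" if "\<xi> \<in> carrier (HC E n)" for \<xi>
    using that unfolding carrier_HC by (elim imageE) simp
  moreover have "connecting_HC (n - 1) ` carrier (HC EC (n - 1)) \<subseteq> carrier (HC E n)"
    using conn by (auto simp: EC.carrier_HC carrier_HC)
  ultimately have "connecting_HC (n - 1) ` carrier (HC EC (n - 1)) = a_kernel (HC E n) (S n) (\<rho> n)"
    unfolding a_kernel_def' by (rule eq_Collect_restrictI[rotated])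
  then show ?thesis using lin linear_restrict_pair by (simp add: exact_at_def)
qed

text \<open>The composite vanishes already on cochains, both restrictions to
  \<open>A \<inter> B\<close> being the same. Preimages of kernel elements come from
  \<open>restrict_diff_coboundaryE\<close>.\<close>

lemma exact_sum: "exact_at class_ring (HC E n) (\<rho> n) (S n) (\<sigma> n) (HC EC n)"
proof -
  have "\<sigma> n (\<rho> n (HC_class E n \<epsilon>)) = \<zero>\<^bsub>HC EC n\<^esub>" if \<epsilon>: "\<epsilon> \<in> cyclic_cocycles E n" for \<epsilon>
  proof -
    let ?r = "\<lambda>X. restrict \<epsilon> (tests X n)"
    have "lin_comb2 (tests EC n) 1 (restrict (?r EA) (tests EC n)) (-1) (restrict (?r EB) (tests EC n))
        = lin_comb2 (tests EC n) 0 (?r EC) 0 (?r EC)"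
      using tests_inter by (auto simp: lin_comb2_def restrict_def)
    moreover have "lin_comb2 (tests EC n) 0 (?r EC) 0 (?r EC) \<in> cyclic_coboundaries EC n"
      by (rule EC.zero_cyclic_coboundaries)
    moreover from this have "HC_class EC n (lin_comb2 (tests EC n) 0 (?r EC) 0 (?r EC)) = \<zero>\<^bsub>HC EC n\<^esub>"
      using EC.HC_class_zero_iff EC.cyclic_coboundaries_subset by blast
    ultimately show ?thesis
      using \<epsilon> by (simp add: restrict_pair_class restrict_diff_class restrict_cocycles)
  qed
  moreover have "(HC_class EA n \<alpha>, HC_class EB n \<beta>) \<in> \<rho> n ` carrier (HC E n)"
    if \<alpha>: "\<alpha> \<in> cyclic_cocycles EA n" and \<beta>: "\<beta> \<in> cyclic_cocycles EB n"
      and "\<sigma> n (HC_class EA n \<alpha>, HC_class EB n \<beta>) = \<zero>\<^bsub>HC EC n\<^esub>" for \<alpha> \<beta>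
  proof -
    let ?d = "lin_comb2 (tests EC n) 1 (restrict \<alpha> (tests EC n)) (-1) (restrict \<beta> (tests EC n))"
    have "?d \<in> cyclic_cocycles EC n"
      using \<alpha> \<beta> restrict_cocycles(3,4) EC.cyclic_cocycles_lin_comb2 by blast
    then have "?d \<in> cyclic_coboundaries EC n"
      using that EC.HC_class_zero_iff by (simp add: restrict_diff_class)
    then obtain \<epsilon> where \<epsilon>: "\<epsilon> \<in> cyclic_cocycles E n"
      "lin_comb2 (tests EA n) 1 (restrict \<epsilon> (tests EA n)) (-1) \<alpha> \<in> cyclic_coboundaries EA n"
      "restrict \<epsilon> (tests EB n) = \<beta>"
      using restrict_diff_coboundaryE[OF \<alpha> \<beta>] by blast
    then have "\<rho> n (HC_class E n \<epsilon>) = (HC_class EA n \<alpha>, HC_class EB n \<beta>)"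
      using EA.HC_class_eq_iff[OF restrict_cocycles(1)[OF \<epsilon>(1)] \<alpha>]
      by (simp add: restrict_pair_class)
    then show ?thesis using \<epsilon>(1) by (force simp: carrier_HC)
  qed
  moreover have "\<rho> n (HC_class E n \<epsilon>) \<in> carrier (S n)" if "\<epsilon> \<in> cyclic_cocycles E n" for \<epsilon>
    using that restrict_cocycles(1,2)
    by (simp add: restrict_pair_class direct_sum_def EA.carrier_HC EB.carrier_HC)
  ultimately have "\<rho> n ` carrier (HC E n) \<subseteq> {p \<in> carrier (S n). \<sigma> n p = \<zero>\<^bsub>HC EC n\<^esub>}"
    and "{p \<in> carrier (S n). \<sigma> n p = \<zero>\<^bsub>HC EC n\<^esub>} \<subseteq> \<rho> n ` carrier (HC E n)"
    by (auto simp: carrier_HC) (auto simp: direct_sum_def EA.carrier_HC EB.carrier_HC)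
  then have "\<rho> n ` carrier (HC E n) = {p \<in> carrier (S n). \<sigma> n p = \<zero>\<^bsub>HC EC n\<^esub>}"
    by (rule subset_antisym)
  then have "\<rho> n ` carrier (HC E n) = a_kernel (S n) (HC EC n) (\<sigma> n)"
    by (simp add: a_kernel_def')
  then show ?thesis using linear_restrict_pair linear_restrict_diff by (simp add: exact_at_def)
qed

text \<open>Image and kernel are both described as the classes of differences of cocycles on
  \<open>A\<close> and \<open>B\<close>. For the kernel, \<open>connecting_coboundaryE\<close> and
  \<open>connecting_coboundaryI\<close> give the two directions.\<close>

lemma exact_intersection:
  "exact_at class_ring (S n) (\<sigma> n) (HC EC n) (connecting_HC n) (HC E (n + 1))"
proof -
  let ?d = "\<lambda>\<alpha> \<beta>. lin_comb2 (tests EC n) 1 (restrict \<alpha> (tests EC n)) (-1) (restrict \<beta> (tests EC n))"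
  have d: "?d \<alpha> \<beta> \<in> cyclic_cocycles EC n"
    if "\<alpha> \<in> cyclic_cocycles EA n" "\<beta> \<in> cyclic_cocycles EB n" for \<alpha> \<beta>
    using that restrict_cocycles(3,4) EC.cyclic_cocycles_lin_comb2 by blast
  have "connecting_HC n (HC_class EC n \<gamma>) = \<zero>\<^bsub>HC E (n + 1)\<^esub>
    \<longleftrightarrow> (\<exists>\<alpha>\<in>cyclic_cocycles EA n. \<exists>\<beta>\<in>cyclic_cocycles EB n. HC_class EC n \<gamma> = HC_class EC n (?d \<alpha> \<beta>))"
    (is "?L \<longleftrightarrow> ?R") if \<gamma>: "\<gamma> \<in> cyclic_cocycles EC n" for \<gamma>
  proof
    assume ?L
    then have "connecting n \<gamma> \<in> cyclic_coboundaries E (n + 1)"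
      using \<gamma> HC_class_zero_iff connecting_cocycle by (simp add: connecting_HC_class)
    then obtain \<alpha> \<beta> where ab: "\<alpha> \<in> cyclic_cocycles EA n" "\<beta> \<in> cyclic_cocycles EB n"
      "\<And>as. as \<in> tests EC n \<Longrightarrow> \<gamma> as = \<alpha> as - \<beta> as"
      using connecting_coboundaryE[OF \<gamma>] by blast
    \<comment> \<open>The equality holds for cochains, not just classes, since both sides are
      undefined off the tests of \<open>A \<inter> B\<close>.\<close>
    have "\<gamma> = ?d \<alpha> \<beta>"
      using EC.cyclic_cocycles_ext[OF \<gamma>] ab(3)
      by (intro extensionalityI[of _ "tests EC n"]) (auto simp: lin_comb2_def)
    then show ?R using ab by blast
  next
    assume ?R
    then obtain \<alpha> \<beta> where ab: "\<alpha> \<in> cyclic_cocycles EA n" "\<beta> \<in> cyclic_cocycles EB n"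
      "HC_class EC n \<gamma> = HC_class EC n (?d \<alpha> \<beta>)" by blast
    then have "lin_comb2 (tests EC n) 1 \<gamma> (-1) (?d \<alpha> \<beta>) \<in> cyclic_coboundaries EC n"
      using EC.HC_class_eq_iff[OF \<gamma> d] by simp
    then obtain \<eta> where \<eta>: "\<eta> \<in> cyclic_cochains EC (n - 1)"
      "lin_comb2 (tests EC n) 1 \<gamma> (-1) (?d \<alpha> \<beta>) = coboundary EC (n - 1) \<eta>"
      by (auto simp: cyclic_coboundaries_def)
    have "connecting n \<gamma> \<in> cyclic_coboundaries E (n + 1)"
      using \<gamma> ab(1,2) \<eta>(1)
      by (rule connecting_coboundaryI) (simp add: lin_comb2_apply flip: \<eta>(2))
    then show ?L using \<gamma> HC_class_zero_iff connecting_cocycle by (simp add: connecting_HC_class)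
  qed
  then have ker: "connecting_HC n \<xi> = \<zero>\<^bsub>HC E (n + 1)\<^esub>
    \<longleftrightarrow> (\<exists>\<alpha>\<in>cyclic_cocycles EA n. \<exists>\<beta>\<in>cyclic_cocycles EB n. \<xi> = HC_class EC n (?d \<alpha> \<beta>))"
    if "\<xi> \<in> carrier (HC EC n)" for \<xi>
    using that unfolding EC.carrier_HC by (elim imageE) simp
  have im: "\<xi> \<in> \<sigma> n ` carrier (S n)
    \<longleftrightarrow> (\<exists>\<alpha>\<in>cyclic_cocycles EA n. \<exists>\<beta>\<in>cyclic_cocycles EB n. \<xi> = HC_class EC n (?d \<alpha> \<beta>))" for \<xi>
    by (force simp: direct_sum_def EA.carrier_HC EB.carrier_HC restrict_diff_class)
  have "\<sigma> n ` carrier (S n) = a_kernel (HC EC n) (HC E (n + 1)) (connecting_HC n)"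
    unfolding a_kernel_def'
  proof (rule eq_Collect_restrictI)
    show "\<sigma> n ` carrier (S n) \<subseteq> carrier (HC EC n)"
      using d by (intro subsetI, unfold im) (auto simp: EC.carrier_HC)
  qed (simp only: im ker)
  then show ?thesis using linear_restrict_diff linear_connecting by (simp add: exact_at_def)
qed

end

theorem theorem7p1:
  fixes E :: "'a effect_algebra" and A B :: "'a set"
  assumes "effect_algebra E"
    and "effect_subalgebra A E" and "effect_subalgebra B E"
    and "carrier E = A \<union> B"
  shows "let EA = E\<lparr>carrier := A\<rparr>; EB = E\<lparr>carrier := B\<rparr>; EAB = E\<lparr>carrier := A \<inter> B\<rparr>;
             S = (\<lambda>n. direct_sum (HC EA n) (HC EB n));
             \<rho> = HC_restrict_pair EA EB; \<sigma> = HC_restrict_diff EAB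
         in \<exists>\<delta>. \<forall>n::int.
              exact_at class_ring (HC EAB (n - 1)) (\<delta> (n - 1)) (HC E n) (\<rho> n) (S n) \<and>
              exact_at class_ring (HC E n) (\<rho> n) (S n) (\<sigma> n) (HC EAB n) \<and>
              exact_at class_ring (S n) (\<sigma> n) (HC EAB n) (\<delta> n) (HC E (n + 1))"
proof -
  interpret effect_algebra_union E A B
    using assms by (simp add: effect_algebra_union_def effect_algebra_union_axioms_def)
  show ?thesis
    \<comment> \<open>The witness for \<open>\<delta>\<close> is \<open>connecting_HC\<close>, a
      single family for all degrees, so that the three exactness statements fit together into one
      sequence.\<close>
    unfolding Let_def using exact_ambient exact_sum exact_intersection by blast
qed

end
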